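(* Let $\varepsilon<1$ be any constant and let $C$ be a sufficiently large constant. Let $p=p(n)$ satisfy $Cn^{-1/4}(\ln n)^{9/4}\le p<\varepsilon$. Then with high probability \[\tau_2(G_{n,p})=(2+o(1))\,\chi(G_{n,p}).\]
   Context: For a positive integer $t$ and a graph $G$, a (proper) $t$-tone $k$-coloring of $G$ is a function $f:V(G)\to\binom{[k]}{t}$ (the $t$-element subsets of $[k]=\{1,\dots,k\}$) such that $|f(u)\cap f(v)|<d(u,v)$ for all distinct vertices $u,v$, where $d(u,v)$ is the graph distance. So for $t=2$: adjacent vertices receive disjoint labels and vertices at distance $2$ receive distinct labels. The $t$-tone chromatic number $\tau_t(G)$ is the least $k$ such that $G$ has a $t$-tone $k$-coloring. $\chi$ denotes the ordinary chromatic number. $G_{n,p}$ is the Erdős–Rényi random graph on vertex set $[n]$ in which each pair is an edge independently with probability $p$. "With high probability" (w.h.p.) means with probability tending to $1$ as $n\to\infty$. *)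

theory Defs
  imports "HOL-Probability.Probability" "HOL-Library.Extended_Nat"
begin

text \<open>Simple graphs on the vertex set V = {0..<n}, given by a set E of 2-element edges.\<close>

definition adj :: "nat set set \<Rightarrow> nat \<Rightarrow> nat \<Rightarrow> bool" where
  "adj E u v \<longleftrightarrow> u \<noteq> v \<and> {u, v} \<in> E"

definition walk :: "nat set set \<Rightarrow> nat \<Rightarrow> nat \<Rightarrow> nat \<Rightarrow> bool" where
  "walk E u v k \<longleftrightarrow> (\<exists>xs. length xs = Suc k \<and> xs ! 0 = u \<and> xs ! k = v \<and>
      (\<forall>i<k. adj E (xs ! i) (xs ! Suc i)))"

definition gdist :: "nat set set \<Rightarrow> nat \<Rightarrow> nat \<Rightarrow> enat" where
  "gdist E u v = (if \<exists>k. walk E u v k then enat (LEAST k. walk E u v k) else \<infinity>)"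

definition tone_coloring :: "nat \<Rightarrow> nat \<Rightarrow> nat set \<Rightarrow> nat set set \<Rightarrow> (nat \<Rightarrow> nat set) \<Rightarrow> bool" where
  "tone_coloring t k V E f \<longleftrightarrow>
     (\<forall>v\<in>V. f v \<subseteq> {1..k} \<and> card (f v) = t) \<and>
     (\<forall>u\<in>V. \<forall>v\<in>V. u \<noteq> v \<longrightarrow> enat (card (f u \<inter> f v)) < gdist E u v)"

definition tone_number :: "nat \<Rightarrow> nat set \<Rightarrow> nat set set \<Rightarrow> nat" where
  "tone_number t V E = (LEAST k. \<exists>f. tone_coloring t k V E f)"

definition chromatic_number :: "nat set \<Rightarrow> nat set set \<Rightarrow> nat" where
  "chromatic_number V E = (LEAST k. \<exists>c. (\<forall>v\<in>V. c v \<in> {1..k}) \<and>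
      (\<forall>u\<in>V. \<forall>v\<in>V. adj E u v \<longrightarrow> c u \<noteq> c v))"

definition all_edges :: "nat \<Rightarrow> nat set set" where
  "all_edges n = {e. \<exists>u v. u < n \<and> v < n \<and> u \<noteq> v \<and> e = {u, v}}"

definition Gnp :: "nat \<Rightarrow> real \<Rightarrow> nat set set pmf" where
  "Gnp n p = map_pmf (\<lambda>f. {e \<in> all_edges n. f e})
               (Pi_pmf (all_edges n) False (\<lambda>_. bernoulli_pmf p))"

end

theory Submission
  imports Defs "HOL-Real_Asymp.Real_Asymp"
begin

text \<open>
  Put \<open>q = 1 - p\<close>, \<open>L = - ln q\<close> and \<open>x = 2 ln (np) / L\<close>. A first-moment count shows that w.h.p.
  no independent set has more than \<open>a = (1 + \<eta>) x\<close> vertices. This forces at least \<open>n / a\<close> colours in a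
  proper colouring, and \<open>2n / a\<close> in a 2-tone colouring, since its colour classes are independent and
  cover every vertex twice.

  Conversely, Janson's inequality shows that w.h.p. every family of \<open>s = (1 - \<eta>) x\<close> disjoint blocks
  of \<open>M\<close> vertices has an independent transversal; the failure probability \<open>exp (- 2 n ln n)\<close> beats the
  number of families, and this is where the lower bound on \<open>p\<close> is used. Fix a colouring \<open>c\<close> with small
  classes. Any set of more than \<open>m = n / (ln n)^2\<close> vertices can be cut into \<open>s\<close> such blocks that are unions
  of \<open>c\<close>-classes up to trimming, so it contains an independent \<open>s\<close>-set on which \<open>c\<close> is injective.
  Peeling off these sets and colouring the last \<open>m\<close> vertices greedily gives a proper
  colouring with \<open>(1 + o(1)) n / x\<close> colours that is orthogonal to \<open>c\<close>: no two vertices agree in both. Starting from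
  the injective colouring we obtain a proper colouring, and then a second one orthogonal to it; the
  pair of them, on disjoint palettes, is a 2-tone colouring.
\<close>

section \<open>Janson's inequality\<close>

text \<open>Expectation of a function of a random subset of \<open>I\<close> containing each element independently with probability \<open>p\<close>.\<close>

definition bexp :: "real \<Rightarrow> 'a set \<Rightarrow> ('a set \<Rightarrow> real) \<Rightarrow> real" where
  "bexp p I F = (\<Sum>S\<in>Pow I. p ^ card S * (1 - p) ^ card (I - S) * F S)"

lemma bexp_empty [simp]: "bexp p {} F = F {}"
  by (simp add: bexp_def)

text \<open>Conditioning on whether \<open>a\<close> is chosen. The inductions below peel off one
  element at a time with this identity.\<close>

lemma bexp_insert:
  assumes "finite I" "a \<notin> I"
  shows "bexp p (insert a I) F = (1 - p) * bexp p I F + p * bexp p I (\<lambda>S. F (insert a S))"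
proof -
  have inj: "inj_on (insert a) (Pow I)"
    using assms by (auto simp: inj_on_def)
  have disj: "Pow I \<inter> insert a ` Pow I = {}"
    using assms by auto
  have fin: "finite (Pow I)" "finite (insert a ` Pow I)"
    using assms by auto
  have 1: "card (insert a I - S) = Suc (card (I - S))" if "S \<in> Pow I" for S
  proof -
    have "insert a I - S = insert a (I - S)" using that assms by auto
    then show ?thesis using assms that by simp
  qed
  have 2: "card (insert a S) = Suc (card S)" "insert a I - insert a S = I - S" if "S \<in> Pow I" for S
  proof -
    have "a \<notin> S" "finite S" using that assms finite_subset by auto
    then show "card (insert a S) = Suc (card S)" "insert a I - insert a S = I - S"
      using assms by auto
  qed
  show ?thesis
    unfolding bexp_def Pow_insert
    unfolding sum.union_disjoint[OF fin disj] sum.reindex[OF inj] sum_distrib_left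
    by (intro arg_cong2[where f = "(+)"] sum.cong refl) (simp_all only: o_def 1 2 power_Suc mult_ac)
qed

lemma bexp_add: "bexp p I (\<lambda>S. F S + G S) = bexp p I F + bexp p I G"
  by (simp add: bexp_def algebra_simps sum.distrib)

lemma bexp_cmult: "bexp p I (\<lambda>S. c * F S) = c * bexp p I F"
  by (simp add: bexp_def sum_distrib_left mult_ac)

lemma bexp_sum: "bexp p I (\<lambda>S. \<Sum>x\<in>X. F x S) = (\<Sum>x\<in>X. bexp p I (F x))"
  unfolding bexp_def sum_distrib_left by (rule sum.swap)

lemma bexp_const [simp]: "finite I \<Longrightarrow> bexp p I (\<lambda>S. c) = c"
  by (induction I rule: finite_induct) (auto simp: bexp_insert algebra_simps)

lemma bexp_cong:
  "(\<And>S. S \<subseteq> I \<Longrightarrow> F S = G S) \<Longrightarrow> bexp p I F = bexp p I G"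
  by (simp add: bexp_def)

lemma bexp_mono:
  assumes "0 \<le> p" "p \<le> 1" "\<And>S. S \<subseteq> I \<Longrightarrow> F S \<le> G S"
  shows "bexp p I F \<le> bexp p I G"
  unfolding bexp_def using assms by (intro sum_mono mult_left_mono) auto

lemma bexp_nonneg:
  assumes "0 \<le> p" "p \<le> 1" "\<And>S. S \<subseteq> I \<Longrightarrow> 0 \<le> F S"
  shows "0 \<le> bexp p I F"
  unfolding bexp_def using assms by (intro sum_nonneg mult_nonneg_nonneg) auto

text \<open>Induction on \<open>I\<close>. Conditioning on \<open>a\<close> gives two correlated
  halves by the induction hypothesis, and monotonicity orders their means, so the remaining
  covariance term \<open>p * (1 - p) * (F1 - F0) * (G1 - G0)\<close> is nonnegative.\<close>

theorem harris_inequality: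
  assumes "finite I" "0 \<le> p" "p \<le> 1"
    and "\<And>S T. S \<subseteq> T \<Longrightarrow> T \<subseteq> I \<Longrightarrow> F S \<le> F T"
    and "\<And>S T. S \<subseteq> T \<Longrightarrow> T \<subseteq> I \<Longrightarrow> G S \<le> G T"
  shows "bexp p I F * bexp p I G \<le> bexp p I (\<lambda>S. F S * G S)"
  using assms(1,4,5)
proof (induction I arbitrary: F G rule: finite_induct)
  case (insert a I)
  let ?F0 = "bexp p I F" and ?F1 = "bexp p I (\<lambda>S. F (insert a S))"
  let ?G0 = "bexp p I G" and ?G1 = "bexp p I (\<lambda>S. G (insert a S))"
  have 0: "?F0 * ?G0 \<le> bexp p I (\<lambda>S. F S * G S)"
    by (rule insert.IH; rule insert.prems; blast)
  have 1: "?F1 * ?G1 \<le> bexp p I (\<lambda>S. F (insert a S) * G (insert a S))"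
    by (rule insert.IH; rule insert.prems; blast)
  have "?F0 \<le> ?F1" "?G0 \<le> ?G1"
    by (rule bexp_mono[OF assms(2,3)], rule insert.prems; blast)+
  then have "0 \<le> p * (1 - p) * ((?F1 - ?F0) * (?G1 - ?G0))"
    using assms by (intro mult_nonneg_nonneg) auto
  moreover have "(1 - p) * (?F0 * ?G0) + p * (?F1 * ?G1)
      \<le> (1 - p) * bexp p I (\<lambda>S. F S * G S) + p * bexp p I (\<lambda>S. F (insert a S) * G (insert a S))"
    using assms by (intro add_mono mult_left_mono 0 1) auto
  ultimately show ?case
    using insert.hyps by (simp add: bexp_insert algebra_simps)
qed simp

text \<open>Given that \<open>A\<close> is avoided, the coordinates outside \<open>A\<close> are
  still independent with parameter \<open>p\<close>; the branch with some element of
  \<open>A\<close> chosen contributes 0.\<close>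

lemma bexp_avoid:
  assumes "finite I" "A \<subseteq> I"
  shows "bexp p I (\<lambda>S. of_bool (S \<inter> A = {}) * F S) = (1 - p) ^ card A * bexp p (I - A) F"
proof -
  have "finite A" using assms finite_subset by auto
  then show ?thesis using assms
  proof (induction A arbitrary: I rule: finite_induct)
    case (insert a A)
    define J where "J = I - {a}"
    have I: "I = insert a J" "a \<notin> J" "finite J" "A \<subseteq> J"
      using insert by (auto simp: J_def)
    have "bexp p I (\<lambda>S. of_bool (S \<inter> insert a A = {}) * F S)
        = (1 - p) * bexp p J (\<lambda>S. of_bool (S \<inter> insert a A = {}) * F S)"
      using I by (simp add: bexp_insert)
    also have "bexp p J (\<lambda>S. of_bool (S \<inter> insert a A = {}) * F S)
        = bexp p J (\<lambda>S. of_bool (S \<inter> A = {}) * F S)"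
      using I by (intro bexp_cong) (auto simp: disjoint_iff)
    also have "\<dots> = (1 - p) ^ card A * bexp p (J - A) F"
      using I by (intro insert.IH) auto
    also have "J - A = I - insert a A" using I by auto
    finally show ?case using insert.hyps by simp
  qed simp
qed

text \<open>The hypothesis says that \<open>F\<close> ignores the coordinates in \<open>A\<close>,
  so these can be integrated out.\<close>

lemma bexp_marginal:
  assumes "finite I" "A \<subseteq> I" "\<And>S. F S = F (S - A)"
  shows "bexp p I F = bexp p (I - A) F"
proof -
  have "finite A" using assms finite_subset by auto
  then show ?thesis using assms
  proof (induction A arbitrary: I rule: finite_induct)
    case (insert a A)
    define J where "J = I - {a}"
    have I: "I = insert a J" "a \<notin> J" "finite J" "A \<subseteq> J"
      using insert.hyps insert.prems(1,2) by (auto simp: J_def)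
    have F: "F (insert a S) = F S" for S
    proof -
      have "insert a S - insert a A = S - insert a A" by auto
      then show ?thesis using insert.prems(3)[of S] insert.prems(3)[of "insert a S"] by metis
    qed
    have F': "F S = F (S - A)" for S
    proof -
      have "S - A - insert a A = S - insert a A" by auto
      then show ?thesis using insert.prems(3)[of S] insert.prems(3)[of "S - A"] by metis
    qed
    have "bexp p I F = bexp p J F"
      unfolding I(1) bexp_insert[OF I(3,2)] F by (simp add: algebra_simps)
    also have "\<dots> = bexp p (J - A) F" by (rule insert.IH[OF I(3,4) F'])
    also have "J - A = I - insert a A" using I by auto
    finally show ?case .
  qed simp
qed

lemma bexp_indep:
  assumes "finite I" "A \<subseteq> I"
  shows "bexp p I (\<lambda>S. of_bool (S \<inter> A = {})) = (1 - p) ^ card A"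
  using bexp_avoid[OF assms, of p "\<lambda>_. 1"] assms by simp

text \<open>The moment generating function of a binomial variable at 1, for a Chernoff-type bound on
  edge counts.\<close>

lemma bexp_exp_card:
  assumes "finite I" "J \<subseteq> I"
  shows "bexp p I (\<lambda>S. exp (real (card (S \<inter> J)))) = (1 - p + p * exp 1) ^ card J"
  using assms
proof (induction I arbitrary: J rule: finite_induct)
  case (insert a I)
  have fin: "finite S" if "S \<subseteq> I" for S using that insert.hyps finite_subset by auto
  show ?case
  proof (cases "a \<in> J")
    case True
    define J' where "J' = J - {a}"
    have J: "J = insert a J'" "a \<notin> J'" "J' \<subseteq> I" "finite J'" using True insert.prems insert.hyps
      by (auto simp: J'_def dest: finite_subset)
    have 1: "bexp p I (\<lambda>S. exp (real (card (S \<inter> J)))) = bexp p I (\<lambda>S. exp (real (card (S \<inter> J'))))"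
      using insert.hyps J by (intro bexp_cong) (auto intro!: arg_cong[where f=card])
    have 2: "bexp p I (\<lambda>S. exp (real (card (insert a S \<inter> J)))) =
             bexp p I (\<lambda>S. exp 1 * exp (real (card (S \<inter> J'))))"
    proof (rule bexp_cong)
      fix S assume S: "S \<subseteq> I"
      have "insert a S \<inter> J = insert a (S \<inter> J')" using J S insert.hyps by auto
      then have "card (insert a S \<inter> J) = Suc (card (S \<inter> J'))" using J fin[OF S] by simp
      then show "exp (real (card (insert a S \<inter> J))) = exp 1 * exp (real (card (S \<inter> J')))"
        by (simp add: exp_add[symmetric])
    qed
    show ?thesis
      unfolding bexp_insert[OF insert.hyps(1,2)] 1 2 bexp_cmult insert.IH[OF J(3)]
      using J by (subst J(1)) (simp add: algebra_simps)
  next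
    case False
    then have "J \<subseteq> I" using insert.prems by auto
    then show ?thesis using insert False by (simp add: bexp_insert algebra_simps)
  qed
qed simp

text \<open>
  With \<open>N\<close> the number of avoided sets, Harris' inequality gives
  \<open>- d/dt E exp(-tN) \<ge> (\<mu> - t\<Delta>) E exp(-tN)\<close>; integrate up to \<open>t = \<mu> / \<Delta>\<close>.
\<close>

theorem janson_inequality:
  fixes A :: "'x \<Rightarrow> 'a set"
  assumes fin: "finite I" "finite X" and p: "0 \<le> p" "p \<le> 1"
    and A: "\<And>x. x \<in> X \<Longrightarrow> A x \<subseteq> I"
    and mu: "\<mu> = (\<Sum>x\<in>X. (1 - p) ^ card (A x))"
    and Delta: "(\<Sum>x\<in>X. \<Sum>y\<in>{y\<in>X. A x \<inter> A y \<noteq> {}}. (1 - p) ^ card (A x \<union> A y)) \<le> \<Delta>"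
    and pos: "0 < \<Delta>" "0 \<le> \<mu>"
  shows "bexp p I (\<lambda>S. of_bool (\<forall>x\<in>X. S \<inter> A x \<noteq> {})) \<le> exp (- \<mu>\<^sup>2 / (2 * \<Delta>))"
proof -
  define q where "q = 1 - p"
  define ind where "ind x S = (of_bool (S \<inter> A x = {}) :: real)" for x S
  define N where "N S = (\<Sum>x\<in>X. ind x S)" for S
  define \<Psi> where "\<Psi> t = bexp p I (\<lambda>S. exp (- t * N S))" for t
  \<comment> \<open>\<open>Y x\<close> contains \<open>x\<close> itself when \<open>A x\<close> is
    nonempty, so \<open>\<Delta>\<close> bounds the sum over ordered dependent pairs with the
    diagonal included.\<close>
  define Y where "Y x = {y\<in>X. A x \<inter> A y \<noteq> {}}" for x
  define Z where "Z x = {y\<in>X. A x \<inter> A y = {}}" for x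
  have q: "0 \<le> q" "q \<le> 1" using p by (auto simp: q_def)
  have ind_anti: "ind x T \<le> ind x S" if "S \<subseteq> T" for x S T
    using that by (auto simp: ind_def)
  have YZ: "finite (Y x)" "finite (Z x)" "Y x \<inter> Z x = {}" "X = Y x \<union> Z x" for x
    using fin by (auto simp: Y_def Z_def)
  have N_split: "N S = (\<Sum>y\<in>Y x. ind y S) + (\<Sum>y\<in>Z x. ind y S)" for x S
    unfolding N_def using YZ[of x] by (metis sum.union_disjoint)
  have N_nonneg: "0 \<le> N S" for S by (simp add: N_def ind_def sum_nonneg)
  have deriv: "(\<Psi> has_real_derivative - bexp p I (\<lambda>S. N S * exp (- t * N S))) (at t)" for t
    unfolding \<Psi>_def bexp_def
    by (auto intro!: derivative_eq_intros simp: sum_negf[symmetric] algebra_simps intro!: sum.cong)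
  have \<Psi>_nonneg: "0 \<le> \<Psi> t" for t
    unfolding \<Psi>_def using p by (intro bexp_nonneg) auto
  have term_bound: "(q ^ card (A x) - t * (\<Sum>y\<in>Y x. q ^ card (A x \<union> A y))) * \<Psi> t
      \<le> bexp p I (\<lambda>S. ind x S * exp (- t * N S))" if x: "x \<in> X" and t: "0 \<le> t" for x t
  proof -
    let ?J = "I - A x"
    let ?y = "\<lambda>S. exp (- t * (\<Sum>y\<in>Y x. ind y S))" and ?z = "\<lambda>S. exp (- t * (\<Sum>y\<in>Z x. ind y S))"
    have "bexp p I (\<lambda>S. ind x S * exp (- t * N S)) = q ^ card (A x) * bexp p ?J (\<lambda>S. exp (- t * N S))"
      unfolding ind_def q_def by (rule bexp_avoid[OF fin(1) A[OF x]])
    moreover have "(\<lambda>S. exp (- t * N S)) = (\<lambda>S. ?y S * ?z S)"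
      by (simp add: N_split[of _ x] exp_add[symmetric] algebra_simps)
    ultimately have eq: "bexp p I (\<lambda>S. ind x S * exp (- t * N S))
        = q ^ card (A x) * bexp p ?J (\<lambda>S. ?y S * ?z S)" by simp
    \<comment> \<open>A larger \<open>S\<close> avoids fewer sets, so both exponentials increase
      with \<open>S\<close> and are positively correlated.\<close>
    have harris: "bexp p ?J ?y * bexp p ?J ?z \<le> bexp p ?J (\<lambda>S. ?y S * ?z S)"
    proof (rule harris_inequality)
      fix S T :: "'a set" assume "S \<subseteq> T"
      then have "(\<Sum>y\<in>R. ind y T) \<le> (\<Sum>y\<in>R. ind y S)" for R
        by (intro sum_mono ind_anti)
      then show "?y S \<le> ?y T" "?z S \<le> ?z T" using t by (auto intro: mult_left_mono)
    qed (use fin p in auto)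
    \<comment> \<open>Sets indexed by \<open>Z x\<close> are disjoint from \<open>A x\<close>, so
      conditioning on the avoidance of \<open>A x\<close> leaves this factor unchanged. Dropping the
      \<open>Y x\<close> part of \<open>N\<close> then bounds it below by
      \<open>\<Psi> t\<close>.\<close>
    have "bexp p I ?z = bexp p ?J ?z"
    proof (rule bexp_marginal)
      fix S
      have "ind y (S - A x) = ind y S" if "y \<in> Z x" for y
        using that by (auto simp: ind_def Z_def disjoint_iff)
      then show "?z S = ?z (S - A x)" by simp
    qed (use fin A x in auto)
    moreover have "\<Psi> t \<le> bexp p I ?z"
      unfolding \<Psi>_def
    proof (rule bexp_mono)
      fix S
      have "0 \<le> (\<Sum>y\<in>Y x. ind y S)" by (simp add: ind_def sum_nonneg)
      then show "exp (- t * N S) \<le> ?z S"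
        using t by (simp add: N_split[of _ x] mult_left_mono)
    qed (use p in auto)
    ultimately have z: "\<Psi> t \<le> bexp p ?J ?z" by simp
    \<comment> \<open>Linearising the exponential reduces the dependent factor to a sum of avoidance
      probabilities.\<close>
    have "bexp p ?J (\<lambda>S. 1 + - t * (\<Sum>y\<in>Y x. ind y S)) \<le> bexp p ?J ?y"
      using p by (intro bexp_mono exp_ge_add_one_self) auto
    also have "bexp p ?J (\<lambda>S. 1 + - t * (\<Sum>y\<in>Y x. ind y S)) = 1 - t * (\<Sum>y\<in>Y x. bexp p ?J (ind y))"
      using fin by (subst bexp_add, subst bexp_cmult) (simp add: bexp_sum)
    also have "(\<Sum>y\<in>Y x. bexp p ?J (ind y)) = (\<Sum>y\<in>Y x. q ^ card (A y - A x))"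
    proof (rule sum.cong)
      fix y assume y: "y \<in> Y x"
      have "bexp p ?J (ind y) = bexp p ?J (\<lambda>S. of_bool (S \<inter> (A y - A x) = {}))"
        by (intro bexp_cong) (auto simp: ind_def)
      also have "\<dots> = q ^ card (A y - A x)"
        unfolding q_def using fin A y by (intro bexp_indep) (auto simp: Y_def)
      finally show "bexp p ?J (ind y) = q ^ card (A y - A x)" .
    qed simp
    finally have y: "1 - t * (\<Sum>y\<in>Y x. q ^ card (A y - A x)) \<le> bexp p ?J ?y" .
    have "0 \<le> bexp p ?J ?y" using p by (intro bexp_nonneg) auto
    then have "bexp p ?J ?y * \<Psi> t \<le> bexp p ?J ?y * bexp p ?J ?z"
      using z by (intro mult_left_mono)
    moreover have "(1 - t * (\<Sum>y\<in>Y x. q ^ card (A y - A x))) * \<Psi> t \<le> bexp p ?J ?y * \<Psi> t"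
      using y \<Psi>_nonneg by (intro mult_right_mono)
    ultimately have "(1 - t * (\<Sum>y\<in>Y x. q ^ card (A y - A x))) * \<Psi> t \<le> bexp p ?J (\<lambda>S. ?y S * ?z S)"
      using harris by linarith
    then have "q ^ card (A x) * ((1 - t * (\<Sum>y\<in>Y x. q ^ card (A y - A x))) * \<Psi> t)
        \<le> bexp p I (\<lambda>S. ind x S * exp (- t * N S))"
      unfolding eq using q by (intro mult_left_mono) auto
    moreover have "q ^ card (A x \<union> A y) = q ^ card (A x) * q ^ card (A y - A x)" if "y \<in> Y x" for y
    proof -
      have "finite (A x)" "finite (A y)"
        using A[OF x] A[of y] that fin(1) finite_subset by (fastforce simp: Y_def)+
      then have "card (A x \<union> A y) = card (A x) + card (A y - A x)"
        by (subst card_Un_disjoint[symmetric]) auto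
      then show ?thesis by (simp add: power_add)
    qed
    then have "(\<Sum>y\<in>Y x. q ^ card (A x \<union> A y)) = q ^ card (A x) * (\<Sum>y\<in>Y x. q ^ card (A y - A x))"
      by (simp add: sum_distrib_left)
    ultimately show ?thesis by (simp add: algebra_simps)
  qed
  have deriv_bound: "(\<mu> - t * \<Delta>) * \<Psi> t \<le> bexp p I (\<lambda>S. N S * exp (- t * N S))" if t: "0 \<le> t" for t
  proof -
    have "t * (\<Sum>x\<in>X. \<Sum>y\<in>Y x. q ^ card (A x \<union> A y)) \<le> t * \<Delta>"
      using Delta t by (intro mult_left_mono) (auto simp: Y_def q_def)
    then have "(\<mu> - t * \<Delta>) * \<Psi> t \<le> (\<mu> - t * (\<Sum>x\<in>X. \<Sum>y\<in>Y x. q ^ card (A x \<union> A y))) * \<Psi> t"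
      using \<Psi>_nonneg by (intro mult_right_mono) auto
    also have "\<dots> = (\<Sum>x\<in>X. (q ^ card (A x) - t * (\<Sum>y\<in>Y x. q ^ card (A x \<union> A y))) * \<Psi> t)"
      by (simp add: mu q_def sum_subtractf sum_distrib_left sum_distrib_right left_diff_distrib)
    also have "\<dots> \<le> (\<Sum>x\<in>X. bexp p I (\<lambda>S. ind x S * exp (- t * N S)))"
      using t by (intro sum_mono term_bound)
    also have "\<dots> = bexp p I (\<lambda>S. N S * exp (- t * N S))"
      by (simp add: N_def bexp_sum[symmetric] sum_distrib_right)
    finally show ?thesis .
  qed
  \<comment> \<open>The second factor is the integrating factor of the differential inequality, so
    \<open>g\<close> cannot increase for nonnegative \<open>t\<close>. The choice
    \<open>t = \<mu> / \<Delta>\<close> maximises the exponent.\<close>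
  define g where "g t = \<Psi> t * exp (\<mu> * t - \<Delta> * t\<^sup>2 / 2)" for t
  define t where "t = \<mu> / \<Delta>"
  have t: "0 \<le> t" using pos by (simp add: t_def)
  have "g t \<le> g 0"
  proof (rule DERIV_nonpos_imp_nonincreasing[OF t])
    fix u :: real assume u: "0 \<le> u"
    let ?e = "exp (\<mu> * u - \<Delta> * u\<^sup>2 / 2)"
    have "((\<lambda>t. exp (\<mu> * t - \<Delta> * t\<^sup>2 / 2)) has_real_derivative (\<mu> - u * \<Delta>) * ?e) (at u)"
      by (auto intro!: derivative_eq_intros simp: algebra_simps)
    from DERIV_mult[OF deriv this] have "(g has_real_derivative
        (- bexp p I (\<lambda>S. N S * exp (- u * N S)) + \<Psi> u * (\<mu> - u * \<Delta>)) * ?e) (at u)"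
      unfolding g_def by (simp add: algebra_simps)
    moreover have "(- bexp p I (\<lambda>S. N S * exp (- u * N S)) + \<Psi> u * (\<mu> - u * \<Delta>)) * ?e \<le> 0"
      using deriv_bound[OF u] by (intro mult_nonpos_nonneg) (auto simp: algebra_simps)
    ultimately show "\<exists>y. (g has_real_derivative y) (at u) \<and> y \<le> 0" by blast
  qed
  moreover have "g 0 = 1" using fin by (simp add: g_def \<Psi>_def)
  moreover have "\<mu> * t - \<Delta> * t\<^sup>2 / 2 = \<mu>\<^sup>2 / (2 * \<Delta>)"
    using pos by (simp add: t_def field_simps power2_eq_square)
  ultimately have "\<Psi> t \<le> exp (- \<mu>\<^sup>2 / (2 * \<Delta>))"
    by (simp add: g_def exp_minus field_simps)
  moreover have "bexp p I (\<lambda>S. of_bool (\<forall>x\<in>X. S \<inter> A x \<noteq> {})) \<le> \<Psi> t"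
    unfolding \<Psi>_def
  proof (rule bexp_mono)
    fix S
    have "N S = 0" if "\<forall>x\<in>X. S \<inter> A x \<noteq> {}"
      using that by (simp add: N_def ind_def)
    then show "of_bool (\<forall>x\<in>X. S \<inter> A x \<noteq> {}) \<le> exp (- t * N S)" by auto
  qed (use p in auto)
  ultimately show ?thesis by linarith
qed

section \<open>Orthogonal colourings\<close>

definition stable_set :: "nat set set \<Rightarrow> nat set \<Rightarrow> bool" where
  "stable_set E S \<longleftrightarrow> (\<forall>u\<in>S. \<forall>v\<in>S. \<not> adj E u v)"

text \<open>A vertex mapped to \<open>s\<close> lies in none of the blocks.\<close>

definition has_independent_transversals :: "nat \<Rightarrow> nat set set \<Rightarrow> nat \<Rightarrow> nat \<Rightarrow> bool" where
  "has_independent_transversals n E s M \<longleftrightarrow>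
     (\<forall>w \<in> {0..<n} \<rightarrow>\<^sub>E {..s}. (\<forall>i<s. card {v\<in>{0..<n}. w v = i} = M) \<longrightarrow>
        (\<exists>x. (\<forall>i<s. x i \<in> {0..<n} \<and> w (x i) = i) \<and> stable_set E (x ` {..<s})))"

text \<open>The condition covers all subsets of a small set too, so every subgraph induced on at
  most \<open>m\<close> vertices is \<open>D\<close>-degenerate and can be coloured
  greedily.\<close>

definition locally_degenerate :: "nat \<Rightarrow> nat set set \<Rightarrow> real \<Rightarrow> nat \<Rightarrow> bool" where
  "locally_degenerate n E m D \<longleftrightarrow>
     (\<forall>S\<subseteq>{0..<n}. S \<noteq> {} \<longrightarrow> real (card S) \<le> m \<longrightarrow> (\<exists>v\<in>S. card {u\<in>S. adj E u v} \<le> D))"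

text \<open>The last clause makes \<open>v \<mapsto> (c v, d v)\<close> injective on
  \<open>U\<close>. With \<open>c = id\<close> these are the proper colourings of \<open>U\<close>,
  so one construction yields both colourings that are needed.\<close>

definition orthogonal_coloring ::
    "nat set set \<Rightarrow> (nat \<Rightarrow> nat) \<Rightarrow> nat set \<Rightarrow> nat \<Rightarrow> (nat \<Rightarrow> nat) \<Rightarrow> bool" where
  "orthogonal_coloring E c U k d \<longleftrightarrow>
     (\<forall>v\<in>U. d v \<in> {1..k}) \<and> (\<forall>u\<in>U. \<forall>v\<in>U. adj E u v \<longrightarrow> d u \<noteq> d v) \<and>
     (\<forall>u\<in>U. \<forall>v\<in>U. c u = c v \<longrightarrow> d u = d v \<longrightarrow> u = v)"

section \<open>Peeling off rainbow independent sets and colouring the remainder greedily\<close>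

lemma adj_sym: "adj E u v \<longleftrightarrow> adj E v u"
  by (auto simp: adj_def insert_commute)

text \<open>Add elements one by one: the first time the sum reaches \<open>M\<close>, it overshoots
  by at most the last summand.\<close>

lemma subset_sum_in_window:
  fixes f :: "'a \<Rightarrow> nat"
  assumes "finite T" "\<And>x. x \<in> T \<Longrightarrow> f x \<le> a" "M \<le> sum f T"
  shows "\<exists>T'\<subseteq>T. M \<le> sum f T' \<and> sum f T' \<le> M + a"
  using assms
proof (induction T rule: finite_induct)
  case (insert x T)
  show ?case
  proof (cases "M \<le> sum f T")
    case True
    then show ?thesis using insert by (meson insertCI subset_insertI2)
  next
    case False
    then have "sum f (insert x T) \<le> M + a" using insert.hyps insert.prems(1)[of x] by simp
    then show ?thesis using insert.prems by blast
  qed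
qed auto

lemma card_eq_sum_fibres:
  assumes "finite U"
  shows "card U = (\<Sum>y\<in>c ` U. card {v\<in>U. c v = y})"
  using sum.image_gen[OF assms, of "\<lambda>_. 1::nat" c] by simp

text \<open>Blocks are cut off greedily as unions of whole colour classes, which is why the
  partition has the form \<open>g (c v)\<close>. Each block may overshoot \<open>M\<close> by one
  class, hence the size \<open>M + a\<close> per block.\<close>

lemma group_color_classes:
  fixes c :: "nat \<Rightarrow> nat"
  assumes "finite U" "\<And>i. card {v\<in>U. c v = i} \<le> a" "j * (M + a) \<le> card U"
  shows "\<exists>g::nat \<Rightarrow> nat. \<forall>i<j. M \<le> card {v\<in>U. g (c v) = i}"
  using assms
proof (induction j arbitrary: U)
  case (Suc j)
  have "M \<le> (\<Sum>y\<in>c ` U. card {v\<in>U. c v = y})"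
    using Suc.prems(3) card_eq_sum_fibres[OF Suc.prems(1), of c] by simp
  then obtain T where T: "T \<subseteq> c ` U" "M \<le> (\<Sum>y\<in>T. card {v\<in>U. c v = y})"
      "(\<Sum>y\<in>T. card {v\<in>U. c v = y}) \<le> M + a"
    using subset_sum_in_window[of "c ` U" "\<lambda>y. card {v\<in>U. c v = y}" a M] Suc.prems by auto
  define U' where "U' = {v\<in>U. c v \<in> T}"
  have fin: "finite U'" using Suc.prems by (simp add: U'_def)
  have "c ` U' = T" using T by (auto simp: U'_def)
  moreover have "{v\<in>U'. c v = y} = {v\<in>U. c v = y}" if "y \<in> T" for y
    using that by (auto simp: U'_def)
  ultimately have U': "card U' = (\<Sum>y\<in>T. card {v\<in>U. c v = y})"
    using card_eq_sum_fibres[OF fin, of c] by simp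
  have "card (U - U') = card U - card U'"
    using fin by (intro card_Diff_subset) (auto simp: U'_def)
  then have "j * (M + a) \<le> card (U - U')" using U' T Suc.prems(3) by simp
  moreover have "card {v\<in>U - U'. c v = i} \<le> a" for i
  proof -
    have "card {v\<in>U - U'. c v = i} \<le> card {v\<in>U. c v = i}"
      using Suc.prems(1) by (intro card_mono) auto
    then show ?thesis using Suc.prems(2)[of i] by simp
  qed
  ultimately obtain g where g: "\<And>i. i < j \<Longrightarrow> M \<le> card {v\<in>U - U'. g (c v) = i}"
    using Suc.IH[of "U - U'"] Suc.prems(1) by blast
  \<comment> \<open>\<open>U'\<close> contains every vertex of \<open>U\<close> with a colour in
    \<open>T\<close>, so redirecting these colours to \<open>j\<close> leaves the blocks found in
    \<open>U - U'\<close> intact.\<close>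
  define h where "h y = (if y \<in> T then j else g y)" for y
  have "M \<le> card {v\<in>U. h (c v) = i}" if "i < Suc j" for i
  proof (cases "i = j")
    case True
    then have "U' \<subseteq> {v\<in>U. h (c v) = i}" by (auto simp: h_def U'_def)
    then have "card U' \<le> card {v\<in>U. h (c v) = i}"
      using Suc.prems(1) by (intro card_mono) auto
    then show ?thesis using U' T(2) by simp
  next
    case False
    then have "{v\<in>U - U'. g (c v) = i} \<subseteq> {v\<in>U. h (c v) = i}" by (auto simp: h_def U'_def)
    then have "card {v\<in>U - U'. g (c v) = i} \<le> card {v\<in>U. h (c v) = i}"
      using Suc.prems(1) by (intro card_mono) auto
    then show ?thesis using g[of i] False that by simp
  qed
  then show ?case by blast
qed simp

text \<open>Trim each group of colour classes to exactly \<open>M\<close> vertices and take an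
  independent transversal. Different groups share no colour, so \<open>c\<close> is injective on
  it.\<close>

lemma rainbow_independent_set:
  fixes c :: "nat \<Rightarrow> nat"
  assumes tr: "has_independent_transversals n E s M"
    and U: "U \<subseteq> {0..<n}" and a: "\<And>i. card {v\<in>{0..<n}. c v = i} \<le> a" and big: "s * (M + a) \<le> card U"
  shows "\<exists>J\<subseteq>U. card J = s \<and> stable_set E J \<and> inj_on c J"
proof -
  have finU: "finite U" using U finite_subset by blast
  have "card {v\<in>U. c v = i} \<le> a" for i
    using U by (intro order_trans[OF card_mono a[of i]]) auto
  then obtain g :: "nat \<Rightarrow> nat" where g: "\<And>i. i < s \<Longrightarrow> M \<le> card {v\<in>U. g (c v) = i}"
    using group_color_classes[OF finU _ big] by blast
  have "\<exists>W. W \<subseteq> {v\<in>U. g (c v) = i} \<and> card W = M" if "i < s" for i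
    using g[OF that] by (meson obtain_subset_with_card_n)
  then obtain W where W: "\<And>i. i < s \<Longrightarrow> W i \<subseteq> {v\<in>U. g (c v) = i}" "\<And>i. i < s \<Longrightarrow> card (W i) = M"
    by metis
  \<comment> \<open>A vertex can lie only in the block with index \<open>g (c v)\<close>, so no
    other block has to be tested.\<close>
  define w where "w = (\<lambda>v\<in>{0..<n}. if g (c v) < s \<and> v \<in> W (g (c v)) then g (c v) else s)"
  have fib: "{v\<in>{0..<n}. w v = i} = W i" if "i < s" for i
    using W(1)[OF that] U that by (auto simp: w_def)
  have w: "w \<in> {0..<n} \<rightarrow>\<^sub>E {..s}" by (auto simp: w_def)
  have "\<forall>i<s. card {v\<in>{0..<n}. w v = i} = M" using fib W(2) by simp
  then have "\<exists>x. (\<forall>i<s. x i \<in> {0..<n} \<and> w (x i) = i) \<and> stable_set E (x ` {..<s})"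
    using tr w unfolding has_independent_transversals_def by blast
  then obtain x where x: "\<And>i. i < s \<Longrightarrow> x i \<in> {0..<n} \<and> w (x i) = i" "stable_set E (x ` {..<s})"
    by blast
  have xW: "x i \<in> U \<and> g (c (x i)) = i" if "i < s" for i
    using x(1)[OF that] fib[OF that] W(1)[OF that] by blast
  show ?thesis
  proof (intro exI[of _ "x ` {..<s}"] conjI)
    show "x ` {..<s} \<subseteq> U" using xW by auto
    have "inj_on x {..<s}" using xW by (metis inj_onI lessThan_iff)
    then show "card (x ` {..<s}) = s" by (simp add: card_image)
    show "inj_on c (x ` {..<s})" using xW by (auto simp: inj_on_def) metis
  qed (rule x(2))
qed

text \<open>Remove a vertex of low degree, colour the rest, and put it back: its neighbours forbid
  at most \<open>D\<close> colours and its own \<open>c\<close>-class at most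
  \<open>a\<close>.\<close>

lemma greedy_orthogonal_coloring:
  fixes c :: "nat \<Rightarrow> nat"
  assumes deg: "locally_degenerate n E m D"
    and U: "U \<subseteq> {0..<n}" "real (card U) \<le> m" and a: "\<And>i. card {v\<in>{0..<n}. c v = i} \<le> a"
  shows "\<exists>d. orthogonal_coloring E c U (D + a + 1) d"
  using U
proof (induction "card U" arbitrary: U)
  case 0
  then have "U = {}" using finite_subset[OF 0(2)] by simp
  then show ?case by (auto simp: orthogonal_coloring_def)
next
  case (Suc k)
  have fin: "finite U" using Suc.prems finite_subset by blast
  have "U \<noteq> {}" using Suc.hyps(2) by auto
  then obtain v where v: "v \<in> U" "card {u\<in>U. adj E u v} \<le> D"
    using deg Suc.prems unfolding locally_degenerate_def by blast
  have "card (U - {v}) = k" using v fin Suc.hyps(2) by simp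
  then obtain d where d: "orthogonal_coloring E c (U - {v}) (D + a + 1) d"
    using Suc.hyps(1)[of "U - {v}"] Suc.hyps(2) Suc.prems by auto
  \<comment> \<open>The second set contains \<open>v\<close>, so the meaningless value
    \<open>d v\<close> is also forbidden; the count \<open>D + a\<close> already allows for
    it.\<close>
  define F where "F = d ` {u\<in>U. adj E u v} \<union> d ` {u\<in>U. c u = c v}"
  have "card {u\<in>U. c u = c v} \<le> a"
    using Suc.prems by (intro order_trans[OF card_mono a[of "c v"]]) auto
  then have "card F \<le> D + a"
    unfolding F_def using v(2) fin
    by (intro order_trans[OF card_Un_le] add_mono order_trans[OF card_image_le]) auto
  moreover have "finite F" using fin by (auto simp: F_def)
  ultimately have "\<not> {1..D + a + 1} \<subseteq> F" using card_mono[of F "{1..D + a + 1}"] by auto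
  then obtain z where z: "z \<in> {1..D + a + 1}" "z \<notin> F" by blast
  have zd: "d u \<noteq> z" if "u \<in> U" "adj E u v \<or> adj E v u \<or> c u = c v" for u
    using z(2) that adj_sym[of E u v] by (auto simp: F_def)
  have "orthogonal_coloring E c U (D + a + 1) (d(v := z))"
    unfolding orthogonal_coloring_def
  proof (intro conjI ballI impI)
    fix u assume "u \<in> U"
    then show "(d(v := z)) u \<in> {1..D + a + 1}"
      using d z(1) by (simp add: orthogonal_coloring_def)
  next
    fix u u' assume u: "u \<in> U" "u' \<in> U" "adj E u u'"
    then have "u \<noteq> u'" by (simp add: adj_def)
    moreover have "d u \<noteq> d u'" if "u \<noteq> v" "u' \<noteq> v"
      using d u that by (auto simp: orthogonal_coloring_def)
    ultimately show "(d(v := z)) u \<noteq> (d(v := z)) u'"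
      using zd[of u] zd[of u'] u by auto
  next
    fix u u' assume u: "u \<in> U" "u' \<in> U" "c u = c u'" "(d(v := z)) u = (d(v := z)) u'"
    have "u = u'" if "u \<noteq> v" "u' \<noteq> v"
      using d u that by (simp add: orthogonal_coloring_def)
    then show "u = u'" using zd[of u] zd[of u'] u by (auto split: if_splits)
  qed
  then show ?case by blast
qed

text \<open>While more than \<open>m\<close> vertices remain, a rainbow independent set of size
  \<open>s\<close> takes one fresh colour, which removes \<open>s\<close> from both sides of the
  estimate. The greedy colouring of the remainder costs the additive
  \<open>D + a + 1\<close>.\<close>

lemma orthogonal_coloring_exists:
  fixes c :: "nat \<Rightarrow> nat"
  assumes tr: "has_independent_transversals n E s M" and deg: "locally_degenerate n E m D"
    and s: "0 < s" and m: "real (s * (M + a)) \<le> m"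
    and a: "\<And>i. card {v\<in>{0..<n}. c v = i} \<le> a" and U: "U \<subseteq> {0..<n}"
  shows "\<exists>k d. s * k \<le> card U + s * (D + a + 1) \<and> orthogonal_coloring E c U k d"
  using U
proof (induction "card U" arbitrary: U rule: less_induct)
  case less
  have fin: "finite U" using less.prems finite_subset by blast
  show ?case
  proof (cases "real (card U) \<le> m")
    case True
    then show ?thesis using greedy_orthogonal_coloring[OF deg less.prems True a] by (metis le_add2)
  next
    case False
    then have "s * (M + a) \<le> card U" using m by linarith
    then obtain J where J: "J \<subseteq> U" "card J = s" "stable_set E J" "inj_on c J"
      using rainbow_independent_set[OF tr less.prems a] by blast
    have card: "card (U - J) = card U - s" "s \<le> card U"
      using J fin by (auto simp: card_Diff_subset finite_subset card_mono)
    then obtain k d where d: "s * k \<le> card (U - J) + s * (D + a + 1)" "orthogonal_coloring E c (U - J) k d"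
      using less.hyps[of "U - J"] s less.prems by auto
    have rng: "1 \<le> d v" "d v \<le> k" if "v \<in> U" "v \<notin> J" for v
      using d(2) that by (auto simp: orthogonal_coloring_def)
    let ?d = "\<lambda>v. if v \<in> J then Suc k else d v"
    have "orthogonal_coloring E c U (Suc k) ?d"
      unfolding orthogonal_coloring_def
    proof (intro conjI ballI impI)
      fix u assume "u \<in> U"
      then show "?d u \<in> {1..Suc k}" using rng[of u] by auto
    next
      fix u v assume uv: "u \<in> U" "v \<in> U" "adj E u v"
      have "\<not> (u \<in> J \<and> v \<in> J)" using J(3) uv by (auto simp: stable_set_def)
      moreover have "d u \<noteq> d v" if "u \<notin> J" "v \<notin> J"
        using d(2) uv that by (auto simp: orthogonal_coloring_def)
      ultimately show "?d u \<noteq> ?d v" using rng[of u] rng[of v] uv by auto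
    next
      fix u v assume uv: "u \<in> U" "v \<in> U" "c u = c v" "?d u = ?d v"
      then have "u \<in> J \<longleftrightarrow> v \<in> J" using rng[of u] rng[of v] by (auto split: if_splits)
      moreover have "u = v" if "u \<in> J" "v \<in> J" using J(4) uv(3) that by (rule inj_onD)
      moreover have "u = v" if "u \<notin> J" "v \<notin> J"
        using d(2) uv that by (simp add: orthogonal_coloring_def)
      ultimately show "u = v" by blast
    qed
    moreover have "s * Suc k \<le> card U + s * (D + a + 1)" using d(1) card by simp
    ultimately show ?thesis by blast
  qed
qed

section \<open>Graph distance and 2-tone colourings\<close>

lemma gdist_adj:
  assumes "adj E u v"
  shows "gdist E u v \<le> 1"
proof -
  have w: "walk E u v 1"
    unfolding walk_def using assms by (intro exI[of _ "[u, v]"]) auto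
  then have "(LEAST k. walk E u v k) \<le> 1" by (rule Least_le)
  then show ?thesis using w by (auto simp: gdist_def one_enat_def)
qed

lemma gdist_pos:
  assumes "u \<noteq> v"
  shows "1 \<le> gdist E u v"
proof -
  have "\<not> walk E u v 0" using assms by (auto simp: walk_def)
  moreover have "walk E u v (LEAST k. walk E u v k)" if "\<exists>k. walk E u v k"
    using that by (rule LeastI_ex)
  ultimately show ?thesis by (auto simp: gdist_def one_enat_def) (metis Suc_leI gr0I)
qed

text \<open>Nonadjacent vertices may therefore share one label at any distance, even an infinite
  one; only equal labels have to be excluded.\<close>

lemma gdist_nonadj:
  assumes "u \<noteq> v" "\<not> adj E u v"
  shows "2 \<le> gdist E u v"
proof -
  have "\<not> walk E u v 0" using assms by (auto simp: walk_def)
  moreover have "\<not> walk E u v 1" using assms by (auto simp: walk_def)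
  moreover have "walk E u v (LEAST k. walk E u v k)" if "\<exists>k. walk E u v k"
    using that by (rule LeastI_ex)
  ultimately have "2 \<le> (LEAST k. walk E u v k)" if "\<exists>k. walk E u v k"
    using that by (metis One_nat_def less_2_cases_iff not_le_imp_less)
  then show ?thesis by (auto simp: gdist_def numeral_eq_enat)
qed

text \<open>Each colour of a 2-tone colouring labels an independent set, and every vertex is counted twice.\<close>

lemma tone_coloring_lower_bound:
  assumes f: "tone_coloring 2 k {0..<n} E f"
    and a: "\<And>S. S \<subseteq> {0..<n} \<Longrightarrow> stable_set E S \<Longrightarrow> card S \<le> a"
  shows "2 * n \<le> k * a"
proof -
  have fv: "f v \<subseteq> {1..k}" "card (f v) = 2" if "v < n" for v
    using f that by (auto simp: tone_coloring_def)
  have "2 * n = (\<Sum>v\<in>{0..<n}. card (f v))" using fv by simp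
  also have "\<dots> = (\<Sum>v\<in>{0..<n}. \<Sum>i\<in>{1..k}. of_bool (i \<in> f v))"
  proof (rule sum.cong)
    fix v assume "v \<in> {0..<n}"
    then have "f v = {i\<in>{1..k}. i \<in> f v}" using fv[of v] by auto
    then show "card (f v) = (\<Sum>i\<in>{1..k}. of_bool (i \<in> f v))"
      by (simp add: sum.If_cases of_bool_def Int_def)
  qed simp
  also have "\<dots> = (\<Sum>i\<in>{1..k}. \<Sum>v\<in>{0..<n}. of_bool (i \<in> f v))" by (rule sum.swap)
  also have "\<dots> = (\<Sum>i\<in>{1..k}. card {v\<in>{0..<n}. i \<in> f v})"
    by (simp add: sum.If_cases of_bool_def Int_def)
  also have "\<dots> \<le> (\<Sum>i\<in>{1..k}. a)"
  proof (rule sum_mono, rule a)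
    fix i
    show "stable_set E {v \<in> {0..<n}. i \<in> f v}"
      unfolding stable_set_def
    proof (intro ballI notI)
      fix u v assume uv: "u \<in> {v \<in> {0..<n}. i \<in> f v}" "v \<in> {v \<in> {0..<n}. i \<in> f v}" "adj E u v"
      then have "enat (card (f u \<inter> f v)) < gdist E u v"
        using f by (auto simp: tone_coloring_def adj_def)
      also have "\<dots> \<le> 1" using gdist_adj uv by blast
      finally have "card (f u \<inter> f v) = 0" by (simp add: one_enat_def)
      moreover have "finite (f u)" using fv(1)[of u] uv(1) by (auto dest: finite_subset)
      ultimately show False using uv by auto
    qed
  qed auto
  finally show ?thesis by simp
qed

lemma proper_coloring_lower_bound:
  assumes c: "\<And>v. v < n \<Longrightarrow> c v \<in> {1..k}" "\<And>u v. u < n \<Longrightarrow> v < n \<Longrightarrow> adj E u v \<Longrightarrow> c u \<noteq> c v"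
    and a: "\<And>S. S \<subseteq> {0..<n} \<Longrightarrow> stable_set E S \<Longrightarrow> card S \<le> a"
  shows "n \<le> k * a"
proof -
  have "{0..<n} = (\<Union>i\<in>{1..k}. {v\<in>{0..<n}. c v = i})" using c(1) by auto
  then have "n = card (\<Union>i\<in>{1..k}. {v\<in>{0..<n}. c v = i})" by (metis card_atLeastLessThan diff_zero)
  also have "\<dots> \<le> (\<Sum>i\<in>{1..k}. card {v\<in>{0..<n}. c v = i})" by (rule card_UN_le) simp
  also have "\<dots> \<le> (\<Sum>i\<in>{1..k}. a)"
  proof (intro sum_mono a)
    fix i
    show "stable_set E {v \<in> {0..<n}. c v = i}"
      unfolding stable_set_def
    proof (intro ballI notI)
      fix u v assume "u \<in> {v \<in> {0..<n}. c v = i}" "v \<in> {v \<in> {0..<n}. c v = i}" "adj E u v"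
      then show False using c(2)[of u v] by simp
    qed
  qed auto
  finally show ?thesis by simp
qed

text \<open>The deterministic core. The bound \<open>a\<close> on stable sets gives the two lower
  bounds, and two rounds of \<open>orthogonal_coloring_exists\<close> give the two upper
  bounds.\<close>

lemma chromatic_and_tone_number_bounds:
  assumes tr: "has_independent_transversals n E s M" and deg: "locally_degenerate n E m D"
    and a: "\<And>S. S \<subseteq> {0..<n} \<Longrightarrow> stable_set E S \<Longrightarrow> card S \<le> a"
    and s: "0 < s" and m: "real (s * (M + a)) \<le> m" and n: "0 < n"
  shows "n \<le> chromatic_number {0..<n} E * a" "2 * n \<le> tone_number 2 {0..<n} E * a"
    "s * chromatic_number {0..<n} E \<le> n + s * (D + a + 1)"
    "s * tone_number 2 {0..<n} E \<le> 2 * (n + s * (D + a + 1))"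
proof -
  have a1: "card {v\<in>{0..<n}. id v = i} \<le> a" for i
  proof -
    \<comment> \<open>A single vertex is stable, which forces \<open>1 \<le> a\<close> and so covers
      the singleton classes of \<open>id\<close>.\<close>
    have "card {0::nat} \<le> a" using n by (intro a) (auto simp: stable_set_def adj_def)
    moreover have "{v\<in>{0..<n}. id v = i} \<subseteq> {i}" by auto
    ultimately show ?thesis using card_mono[of "{i}" "{v\<in>{0..<n}. id v = i}"] by simp
  qed
  obtain k c where c: "s * k \<le> n + s * (D + a + 1)" "orthogonal_coloring E id {0..<n} k c"
    using orthogonal_coloring_exists[OF tr deg s m a1 order_refl] unfolding card_atLeastLessThan diff_zero by blast
  \<comment> \<open>The classes of the proper colouring \<open>c\<close> are stable, so the same
    \<open>a\<close> bounds them and a second round is possible.\<close>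
  have "card {v\<in>{0..<n}. c v = i} \<le> a" for i
    by (rule a) (use c(2) in \<open>fastforce simp: stable_set_def orthogonal_coloring_def\<close>)+
  then obtain l d where d: "s * l \<le> n + s * (D + a + 1)" "orthogonal_coloring E c {0..<n} l d"
    using orthogonal_coloring_exists[OF tr deg s m _ order_refl] unfolding card_atLeastLessThan diff_zero by blast
  let ?P = "\<lambda>k. \<exists>c. (\<forall>v\<in>{0..<n}. c v \<in> {1..k}) \<and>
      (\<forall>u\<in>{0..<n}. \<forall>v\<in>{0..<n}. adj E u v \<longrightarrow> c u \<noteq> c v)"
  have P: "?P k" using c(2) by (auto simp: orthogonal_coloring_def)
  then have "?P (chromatic_number {0..<n} E)"
    unfolding chromatic_number_def by (rule LeastI)
  then obtain c' where "\<forall>v\<in>{0..<n}. c' v \<in> {1..chromatic_number {0..<n} E}"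
      "\<forall>u\<in>{0..<n}. \<forall>v\<in>{0..<n}. adj E u v \<longrightarrow> c' u \<noteq> c' v" by blast
  then show "n \<le> chromatic_number {0..<n} E * a"
    by (intro proper_coloring_lower_bound[where c = c', OF _ _ a]) auto
  have "chromatic_number {0..<n} E \<le> k"
    unfolding chromatic_number_def using P by (rule Least_le)
  then show "s * chromatic_number {0..<n} E \<le> n + s * (D + a + 1)"
    using c(1) mult_le_mono2 order_trans by blast
  \<comment> \<open>The shift by \<open>k\<close> makes the palettes disjoint: labels have two
    elements, and two labels meet only where the \<open>c\<close>-parts or the
    \<open>d\<close>-parts agree.\<close>
  define f where "f v = {c v, k + d v}" for v
  have rng: "1 \<le> c v" "c v \<le> k" "1 \<le> d v" "d v \<le> l" if "v < n" for v
    using c(2) d(2) that by (auto simp: orthogonal_coloring_def)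
  have c_adj: "c u \<noteq> c v" and d_adj: "d u \<noteq> d v" if "u < n" "v < n" "adj E u v" for u v
    using c(2) d(2) that unfolding orthogonal_coloring_def by (metis atLeastLessThan_iff le0)+
  have orth: "u = v" if "u < n" "v < n" "c u = c v" "d u = d v" for u v
    using d(2) that unfolding orthogonal_coloring_def by (metis atLeastLessThan_iff le0)
  have f: "tone_coloring 2 (k + l) {0..<n} E f"
    unfolding tone_coloring_def
  proof (intro conjI ballI impI)
    fix v assume "v \<in> {0..<n}"
    then have v: "1 \<le> c v" "c v \<le> k" "1 \<le> d v" "d v \<le> l" using rng by auto
    then show "f v \<subseteq> {1..k + l}" by (auto simp: f_def)
    have "c v \<noteq> k + d v" using v by simp
    then show "card (f v) = 2" by (simp add: f_def)
  next
    fix u v assume uv: "u \<in> {0..<n}" "v \<in> {0..<n}" "u \<noteq> v"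
    show "enat (card (f u \<inter> f v)) < gdist E u v"
    proof (cases "adj E u v")
      case True
      then have "c u \<noteq> c v" "d u \<noteq> d v"
        using c_adj d_adj uv by auto
      moreover have "c u \<noteq> k + d v" "c v \<noteq> k + d u" using rng[of u] rng[of v] uv by auto
      ultimately have "f u \<inter> f v = {}" by (simp add: f_def)
      then have "enat (card (f u \<inter> f v)) < 1" by (simp add: zero_enat_def[symmetric])
      then show ?thesis using gdist_pos[OF uv(3)] by (rule order_less_le_trans)
    next
      case False
      have "c u \<noteq> c v \<or> d u \<noteq> d v"
        using orth[of u v] uv by auto
      then have "card (f u \<inter> f v) < 2"
      proof
        assume "c u \<noteq> c v"
        moreover have "c u \<noteq> k + d v" "c v \<noteq> k + d u" using rng[of u] rng[of v] uv by auto
        ultimately have "f u \<inter> f v \<subseteq> {k + d u}" by (auto simp: f_def)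
        then show ?thesis using card_mono[of "{k + d u}" "f u \<inter> f v"] by simp
      next
        assume "d u \<noteq> d v"
        moreover have "c u \<noteq> k + d v" "c v \<noteq> k + d u" using rng[of u] rng[of v] uv by auto
        ultimately have "f u \<inter> f v \<subseteq> {c u}" by (auto simp: f_def)
        then show ?thesis using card_mono[of "{c u}" "f u \<inter> f v"] by simp
      qed
      then have "enat (card (f u \<inter> f v)) < 2" by (simp add: numeral_eq_enat)
      then show ?thesis using gdist_nonadj[OF uv(3) False] by (rule order_less_le_trans)
    qed
  qed
  let ?Q = "\<lambda>k. \<exists>f. tone_coloring 2 k {0..<n} E f"
  have Q: "?Q (k + l)" using f by blast
  then have "?Q (tone_number 2 {0..<n} E)" unfolding tone_number_def by (rule LeastI)
  then show "2 * n \<le> tone_number 2 {0..<n} E * a"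
    using tone_coloring_lower_bound[OF _ a] by blast
  have "tone_number 2 {0..<n} E \<le> k + l" unfolding tone_number_def using Q by (rule Least_le)
  then have "s * tone_number 2 {0..<n} E \<le> s * (k + l)" by (rule mult_le_mono2)
  also have "\<dots> \<le> 2 * (n + s * (D + a + 1))" using c(1) d(1) by (simp add: algebra_simps)
  finally show "s * tone_number 2 {0..<n} E \<le> 2 * (n + s * (D + a + 1))" .
qed

section \<open>Probability bounds\<close>

definition pairs :: "nat set \<Rightarrow> nat set set" where
  "pairs S = {e. e \<subseteq> S \<and> card e = 2}"

lemma all_edges_eq_pairs: "all_edges n = pairs {0..<n}"
  unfolding all_edges_def pairs_def by (auto simp: card_2_iff) fastforce

lemma finite_pairs: "finite S \<Longrightarrow> finite (pairs S)"
  by (simp add: pairs_def)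

lemma card_pairs: "finite S \<Longrightarrow> card (pairs S) = card S choose 2"
  by (simp add: pairs_def n_subsets)

lemma stable_set_iff_pairs:
  assumes "E \<subseteq> all_edges n"
  shows "stable_set E S \<longleftrightarrow> E \<inter> pairs S = {}"
proof
  assume st: "stable_set E S"
  show "E \<inter> pairs S = {}"
  proof (rule ccontr)
    assume "E \<inter> pairs S \<noteq> {}"
    then obtain e where e: "e \<in> E" "e \<subseteq> S" "card e = 2" by (auto simp: pairs_def)
    then obtain u v where "e = {u, v}" "u \<noteq> v" by (auto simp: card_2_iff)
    then show False using st e by (auto simp: stable_set_def adj_def)
  qed
next
  assume d: "E \<inter> pairs S = {}"
  show "stable_set E S"
    unfolding stable_set_def
  proof (intro ballI notI)
    fix u v assume "u \<in> S" "v \<in> S" "adj E u v"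
    then have "{u, v} \<in> E \<inter> pairs S" by (auto simp: adj_def pairs_def)
    then show False using d by simp
  qed
qed

text \<open>Translates probabilities over \<open>Gnp\<close> into the finite sums for which Harris'
  and Janson's inequalities are proved.\<close>

lemma prob_Gnp_eq_bexp:
  assumes p: "0 \<le> p" "p \<le> 1"
  shows "measure_pmf.prob (Gnp n p) A = bexp p (all_edges n) (\<lambda>S. of_bool (S \<in> A))"
proof -
  define I where "I = all_edges n"
  define h :: "(nat set \<Rightarrow> bool) \<Rightarrow> nat set set" where "h f = {e\<in>I. f e}" for f
  define P where "P = Pi_pmf I False (\<lambda>_. bernoulli_pmf p)"
  have fin: "finite I" by (simp add: I_def all_edges_eq_pairs finite_pairs)
  have supp: "set_pmf (Gnp n p) \<subseteq> Pow I" by (auto simp: Gnp_def I_def)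
  have pmf: "pmf (Gnp n p) S = p ^ card S * (1 - p) ^ card (I - S)" if S: "S \<subseteq> I" for S
  proof -
    have "pmf (Gnp n p) S = measure_pmf.prob P (h -` {S})"
      unfolding Gnp_def P_def h_def I_def pmf_map by (rule refl)
    also have "\<dots> = measure_pmf.prob P (h -` {S} \<inter> set_pmf P)"
      by (simp add: measure_Int_set_pmf)
    \<comment> \<open>\<open>h\<close> forgets the values outside \<open>I\<close>, but on the
      support of \<open>P\<close> these are all the default \<open>False\<close>, so
      \<open>S\<close> has at most one preimage there.\<close>
    also have "h -` {S} \<inter> set_pmf P = {\<lambda>e. e \<in> S} \<inter> set_pmf P"
    proof -
      have "f e = (e \<in> S)" if "f \<in> set_pmf P" "h f = S" for f e
      proof (cases "e \<in> I")
        case False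
        then have "f e = False"
          using set_Pi_pmf_subset[OF fin, of False "\<lambda>_. bernoulli_pmf p"] that by (auto simp: P_def)
        then show ?thesis using False S by auto
      qed (use that in \<open>auto simp: h_def\<close>)
      moreover have "h (\<lambda>e. e \<in> S) = S" using S by (auto simp: h_def)
      ultimately show ?thesis by auto
    qed
    also have "measure_pmf.prob P ({\<lambda>e. e \<in> S} \<inter> set_pmf P) = pmf P (\<lambda>e. e \<in> S)"
      by (simp add: measure_Int_set_pmf measure_pmf_single)
    also have "\<dots> = (\<Prod>e\<in>I. pmf (bernoulli_pmf p) (e \<in> S))"
      unfolding P_def using fin S by (subst pmf_Pi') auto
    also have "\<dots> = (\<Prod>e\<in>S. pmf (bernoulli_pmf p) (e \<in> S)) * (\<Prod>e\<in>I - S. pmf (bernoulli_pmf p) (e \<in> S))"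
      unfolding prod.subset_diff[OF S fin] by (rule mult.commute)
    also have "\<dots> = p ^ card S * (1 - p) ^ card (I - S)"
      using p by simp
    finally show ?thesis .
  qed
  have "measure_pmf.prob (Gnp n p) A = measure_pmf.prob (Gnp n p) (A \<inter> set_pmf (Gnp n p))"
    by (simp add: measure_Int_set_pmf)
  also have "A \<inter> set_pmf (Gnp n p) = (A \<inter> Pow I) \<inter> set_pmf (Gnp n p)" using supp by auto
  also have "measure_pmf.prob (Gnp n p) \<dots> = measure_pmf.prob (Gnp n p) (A \<inter> Pow I)"
    by (simp add: measure_Int_set_pmf)
  also have "\<dots> = sum (pmf (Gnp n p)) (A \<inter> Pow I)"
    using fin by (simp add: measure_measure_pmf_finite)
  also have "\<dots> = (\<Sum>S\<in>Pow I. if S \<in> A then pmf (Gnp n p) S else 0)"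
    using fin by (subst Int_commute, subst sum.inter_restrict) auto
  also have "\<dots> = bexp p I (\<lambda>S. of_bool (S \<in> A))"
    unfolding bexp_def by (intro sum.cong) (auto simp: pmf)
  finally show ?thesis by (simp add: I_def)
qed

section \<open>Bounds for the three exceptional events\<close>

lemma bexp_union_bound:
  assumes "0 \<le> p" "p \<le> 1" "finite X"
    and "\<And>S. S \<subseteq> I \<Longrightarrow> Q S \<Longrightarrow> \<exists>x\<in>X. R x S"
  shows "bexp p I (\<lambda>S. of_bool (Q S)) \<le> (\<Sum>x\<in>X. bexp p I (\<lambda>S. of_bool (R x S)))"
proof -
  have "bexp p I (\<lambda>S. of_bool (Q S)) \<le> bexp p I (\<lambda>S. \<Sum>x\<in>X. of_bool (R x S))"
  proof (rule bexp_mono[OF assms(1,2)])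
    fix S assume S: "S \<subseteq> I"
    show "of_bool (Q S) \<le> (\<Sum>x\<in>X. of_bool (R x S) :: real)"
    proof (cases "Q S")
      case True
      then obtain x where x: "x \<in> X" "R x S" using assms(4) S by blast
      then have "of_bool (R x S) \<le> (\<Sum>x\<in>X. of_bool (R x S) :: real)"
        using assms(3) by (intro member_le_sum) auto
      then show ?thesis using x True by simp
    qed (simp add: sum_nonneg)
  qed
  then show ?thesis by (simp add: bexp_sum)
qed

lemma sum_Pow_card:
  fixes g :: "nat \<Rightarrow> real"
  assumes "finite A"
  shows "(\<Sum>L\<in>Pow A. g (card L)) = (\<Sum>l\<le>card A. real (card A choose l) * g l)"
proof -
  have "(\<Sum>L\<in>Pow A. g (card L)) = (\<Sum>l\<le>card A. \<Sum>L\<in>{L\<in>Pow A. card L = l}. g (card L))"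
    using assms by (intro sum.group[symmetric]) (auto intro: card_mono)
  also have "\<dots> = (\<Sum>l\<le>card A. real (card A choose l) * g l)"
  proof (rule sum.cong)
    fix l
    have "(\<Sum>L\<in>{L\<in>Pow A. card L = l}. g (card L)) = real (card {L\<in>Pow A. card L = l}) * g l"
      by simp
    also have "card {L\<in>Pow A. card L = l} = card A choose l"
      using n_subsets[OF assms, of l] by (simp add: Pow_def)
    finally show "(\<Sum>L\<in>{L\<in>Pow A. card L = l}. g (card L)) = real (card A choose l) * g l" .
  qed simp
  finally show ?thesis .
qed

text \<open>First moment over the sets of size exactly \<open>Suc a\<close>, since subsets of stable
  sets are stable.\<close>

lemma large_stable_set_bound:
  assumes p: "0 \<le> p" "p \<le> 1"
  shows "bexp p (all_edges n) (\<lambda>E. of_bool (\<exists>S\<subseteq>{0..<n}. stable_set E S \<and> a < card S))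
    \<le> real (n choose Suc a) * (1 - p) ^ (Suc a choose 2)"
proof -
  let ?X = "{S. S \<subseteq> {0..<n} \<and> card S = Suc a}"
  have finX: "finite ?X" by simp
  have "bexp p (all_edges n) (\<lambda>E. of_bool (\<exists>S\<subseteq>{0..<n}. stable_set E S \<and> a < card S))
    \<le> (\<Sum>S\<in>?X. bexp p (all_edges n) (\<lambda>E. of_bool (E \<inter> pairs S = {})))"
  proof (rule bexp_union_bound[OF p finX])
    fix E assume E: "E \<subseteq> all_edges n" "\<exists>S\<subseteq>{0..<n}. stable_set E S \<and> a < card S"
    then obtain S where S: "S \<subseteq> {0..<n}" "stable_set E S" "Suc a \<le> card S" by auto
    then obtain T where T: "T \<subseteq> S" "card T = Suc a" by (meson obtain_subset_with_card_n)
    then have "stable_set E T" using S by (auto simp: stable_set_def)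
    then show "\<exists>S\<in>?X. E \<inter> pairs S = {}" using T S stable_set_iff_pairs[OF E(1)] by blast
  qed
  also have "\<dots> = (\<Sum>S\<in>?X. (1 - p) ^ (Suc a choose 2))"
  proof (rule sum.cong)
    fix S assume S: "S \<in> ?X"
    then have "finite S" using finite_subset by auto
    moreover have "pairs S \<subseteq> all_edges n" using S by (auto simp: all_edges_eq_pairs pairs_def)
    ultimately show "bexp p (all_edges n) (\<lambda>E. of_bool (E \<inter> pairs S = {})) = (1 - p) ^ (Suc a choose 2)"
      using S by (simp add: bexp_indep all_edges_eq_pairs finite_pairs card_pairs)
  qed simp
  also have "\<dots> = real (n choose Suc a) * (1 - p) ^ (Suc a choose 2)"
    by (simp add: n_subsets)
  finally show ?thesis .
qed

lemma handshake:
  assumes E: "E \<subseteq> all_edges n" and S: "finite S"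
  shows "(\<Sum>v\<in>S. card {u\<in>S. adj E u v}) \<le> 2 * card (E \<inter> pairs S)"
proof -
  let ?F = "E \<inter> pairs S"
  have F: "finite ?F" using finite_pairs[OF S] by simp
  have "(\<Sum>v\<in>S. card {u\<in>S. adj E u v}) \<le> (\<Sum>v\<in>S. card {e\<in>?F. v \<in> e})"
  proof (rule sum_mono)
    fix v assume v: "v \<in> S"
    show "card {u\<in>S. adj E u v} \<le> card {e\<in>?F. v \<in> e}"
    proof (rule card_inj_on_le)
      show "inj_on (\<lambda>u. {u, v}) {u\<in>S. adj E u v}"
        by (auto simp: inj_on_def doubleton_eq_iff)
      show "(\<lambda>u. {u, v}) ` {u\<in>S. adj E u v} \<subseteq> {e\<in>?F. v \<in> e}"
        using v by (auto simp: adj_def pairs_def)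
      show "finite {e\<in>?F. v \<in> e}" by (rule finite_subset[OF _ F]) auto
    qed
  qed
  also have "\<dots> = (\<Sum>v\<in>S. \<Sum>e\<in>?F. of_bool (v \<in> e))"
    using F by (simp add: sum.If_cases of_bool_def Int_def)
  also have "\<dots> = (\<Sum>e\<in>?F. \<Sum>v\<in>S. of_bool (v \<in> e))" by (rule sum.swap)
  also have "\<dots> = (\<Sum>e\<in>?F. 2)"
  proof (rule sum.cong)
    fix e assume e: "e \<in> ?F"
    then have "S \<inter> e = e" "card e = 2" by (auto simp: pairs_def)
    then show "(\<Sum>v\<in>S. of_bool (v \<in> e)) = (2::nat)"
      using S by (simp add: sum.If_cases of_bool_def flip: card_eq_sum)
  qed simp
  finally show ?thesis by simp
qed

text \<open>If all degrees inside \<open>S\<close> exceed \<open>D\<close>, then \<open>S\<close>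
  spans at least \<open>(D + 1) * card S / 2\<close> edges. Exponential Markov costs a factor at
  most \<open>exp (m * p * card S)\<close>, and \<open>4 * m * p \<le> D + 1\<close> makes the gain
  twice as large in the exponent.\<close>

lemma high_degree_subset_bound:
  assumes p: "0 \<le> p" "p \<le> 1" and S: "S \<subseteq> {0..<n}" "real (card S) \<le> m" and D: "4 * m * p \<le> real D + 1"
  shows "bexp p (all_edges n) (\<lambda>E. of_bool (\<forall>v\<in>S. D < card {u\<in>S. adj E u v})) \<le> exp (- (m * p)) ^ card S"
proof -
  let ?k = "card S"
  have fin: "finite S" "finite (all_edges n)"
    using S finite_subset by (auto simp: all_edges_eq_pairs finite_pairs)
  have "bexp p (all_edges n) (\<lambda>E. of_bool (\<forall>v\<in>S. D < card {u\<in>S. adj E u v}))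
      \<le> bexp p (all_edges n) (\<lambda>E. exp (- (real (D + 1) * ?k / 2)) * exp (real (card (E \<inter> pairs S))))"
  proof (rule bexp_mono[OF p])
    fix E assume E: "E \<subseteq> all_edges n"
    have "real (D + 1) * ?k / 2 \<le> real (card (E \<inter> pairs S))" if "\<forall>v\<in>S. D < card {u\<in>S. adj E u v}"
    proof -
      have "(\<Sum>v\<in>S. D + 1) \<le> (\<Sum>v\<in>S. card {u\<in>S. adj E u v})"
        using that by (intro sum_mono) (simp add: Suc_leI)
      also have "\<dots> \<le> 2 * card (E \<inter> pairs S)" by (rule handshake[OF E fin(1)])
      finally have "?k * (D + 1) \<le> 2 * card (E \<inter> pairs S)" by simp
      then have "real (?k * (D + 1)) \<le> real (2 * card (E \<inter> pairs S))" by (rule of_nat_mono)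
      then show ?thesis by (simp add: algebra_simps)
    qed
    then show "of_bool (\<forall>v\<in>S. D < card {u\<in>S. adj E u v})
        \<le> exp (- (real (D + 1) * ?k / 2)) * exp (real (card (E \<inter> pairs S)))"
      by (auto simp: exp_add[symmetric])
  qed
  also have "\<dots> = exp (- (real (D + 1) * ?k / 2)) * (1 - p + p * exp 1) ^ (?k choose 2)"
  proof -
    have "pairs S \<subseteq> all_edges n" using S(1) by (auto simp: all_edges_eq_pairs pairs_def)
    then show ?thesis using fin by (simp only: bexp_cmult bexp_exp_card card_pairs)
  qed
  also have "\<dots> \<le> exp (- (real (D + 1) * ?k / 2)) * exp (m * p * ?k)"
  proof (rule mult_left_mono)
    have "1 - p + p * exp 1 \<le> 1 + 2 * p"
      using exp_le p mult_left_mono[of "exp 1" 3 p] by (simp add: algebra_simps)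
    also have "\<dots> \<le> exp (2 * p)" by (rule exp_ge_add_one_self)
    finally have "(1 - p + p * exp 1) ^ (?k choose 2) \<le> exp (2 * p) ^ (?k choose 2)"
      using p by (intro power_mono) (auto intro!: add_nonneg_nonneg)
    also have "\<dots> = exp (real (?k choose 2) * (2 * p))" by (simp add: exp_of_nat_mult)
    also have "real (?k choose 2) * (2 * p) \<le> m * p * ?k"
    proof -
      have "2 * (?k choose 2) \<le> ?k * (?k - 1)"
        unfolding choose_two using div_times_less_eq_dividend[of "?k * (?k - 1)" 2] by simp
      also have "\<dots> \<le> ?k * ?k" by simp
      finally have "2 * (?k choose 2) \<le> ?k * ?k" .
      then have "real (2 * (?k choose 2)) \<le> real (?k * ?k)" by (rule of_nat_mono)
      also have "\<dots> \<le> m * ?k" using S(2) by (simp add: mult_right_mono)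
      finally have "real (2 * (?k choose 2)) * p \<le> m * ?k * p" using p(1) by (rule mult_right_mono)
      then show ?thesis by (simp add: algebra_simps)
    qed
    finally show "(1 - p + p * exp 1) ^ (?k choose 2) \<le> exp (m * p * ?k)" by simp
  qed simp
  also have "\<dots> = exp (m * p * ?k - real (D + 1) * ?k / 2)" by (simp add: exp_add[symmetric])
  also have "\<dots> \<le> exp (real ?k * - (m * p))"
  proof -
    have "4 * m * p * ?k \<le> (real D + 1) * ?k" using D by (intro mult_right_mono) auto
    then show ?thesis by (simp add: algebra_simps)
  qed
  also have "\<dots> = exp (- (m * p)) ^ ?k" by (rule exp_of_nat_mult)
  finally show ?thesis .
qed

text \<open>Summing the previous bound over all nonempty vertex sets gives a binomial expansion
  without its constant term.\<close>

lemma not_locally_degenerate_bound: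
  assumes p: "0 \<le> p" "p \<le> 1" and D: "4 * m * p \<le> real D + 1"
  shows "bexp p (all_edges n) (\<lambda>E. of_bool (\<not> locally_degenerate n E m D)) \<le> (1 + exp (- (m * p))) ^ n - 1"
proof -
  let ?X = "{S. S \<subseteq> {0..<n} \<and> S \<noteq> {} \<and> real (card S) \<le> m}"
  let ?z = "exp (- (m * p))"
  have finX: "finite ?X" by (rule finite_subset[of _ "Pow {0..<n}"]) auto
  have "bexp p (all_edges n) (\<lambda>E. of_bool (\<not> locally_degenerate n E m D))
     \<le> (\<Sum>S\<in>?X. bexp p (all_edges n) (\<lambda>E. of_bool (\<forall>v\<in>S. D < card {u\<in>S. adj E u v})))"
    by (rule bexp_union_bound[OF p finX]) (simp add: locally_degenerate_def not_le Ball_def Bex_def conj_assoc)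
  also have "\<dots> \<le> (\<Sum>S\<in>?X. ?z ^ card S)"
    by (intro sum_mono high_degree_subset_bound p D) auto
  also have "\<dots> \<le> (\<Sum>S\<in>Pow {0..<n} - {{}}. ?z ^ card S)"
    by (intro sum_mono2) auto
  also have "\<dots> = (\<Sum>S\<in>Pow {0..<n}. ?z ^ card S) - 1"
    by (subst sum_diff1) auto
  also have "(\<Sum>S\<in>Pow {0..<n}. ?z ^ card S) = (1 + ?z) ^ n"
    using binomial_ring[of ?z 1 n] by (simp add: sum_Pow_card add.commute)
  finally show ?thesis .
qed

text \<open>On \<open>L\<close> the values of \<open>y\<close> are dictated by \<open>x\<close>;
  every other coordinate has at most \<open>M\<close> choices.\<close>

lemma card_PiE_agree:
  assumes x: "x \<in> PiE {..<s::nat} W" and W: "\<And>i. i < s \<Longrightarrow> finite (W i)" "\<And>i. i < s \<Longrightarrow> card (W i) = M"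
    and L: "L \<subseteq> {..<s}"
  shows "card {y \<in> PiE {..<s} W. {i\<in>{..<s}. x i = y i} = L} \<le> M ^ (s - card L)"
proof -
  let ?V = "\<lambda>i. if i \<in> L then {x i} else W i"
  have "card {y \<in> PiE {..<s} W. {i\<in>{..<s}. x i = y i} = L} \<le> card (PiE {..<s} ?V)"
  proof (rule card_mono)
    show "finite (PiE {..<s} ?V)" using W by (intro finite_PiE) auto
    show "{y \<in> PiE {..<s} W. {i\<in>{..<s}. x i = y i} = L} \<subseteq> PiE {..<s} ?V"
    proof
      fix y assume "y \<in> {y \<in> PiE {..<s} W. {i\<in>{..<s}. x i = y i} = L}"
      then have y: "y \<in> PiE {..<s} W" "{i\<in>{..<s}. x i = y i} = L" by blast+
      show "y \<in> PiE {..<s} ?V"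
      proof (rule PiE_I)
        fix i assume i: "i \<in> {..<s}"
        have "y i = x i" if "i \<in> L" using y(2) that by auto
        then show "y i \<in> ?V i" using PiE_mem[OF y(1) i] by simp
      next
        fix i assume "i \<notin> {..<s}"
        then show "y i = undefined" by (rule PiE_arb[OF y(1)])
      qed
    qed
  qed
  also have "\<dots> = (\<Prod>i\<in>{..<s}. card (?V i))" by (intro card_PiE finite_lessThan)
  also have "\<dots> = (\<Prod>i\<in>{..<s} - L. card (?V i)) * (\<Prod>i\<in>L. card (?V i))"
    by (rule prod.subset_diff[OF L finite_lessThan])
  also have "\<dots> = M ^ (s - card L)"
  proof -
    have "(\<Prod>i\<in>{..<s} - L. card (?V i)) = (\<Prod>i\<in>{..<s} - L. M)"
      using W(2) by (intro prod.cong refl) simp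
    also have "\<dots> = M ^ (s - card L)"
      using L by (simp add: card_Diff_subset finite_subset[OF L])
    finally show ?thesis by simp
  qed
  finally show ?thesis .
qed

text \<open>Janson's inequality for the edge sets of all transversals. Pairs of transversals are
  grouped by the set \<open>L\<close> of coordinates on which they agree; relative to
  \<open>\<mu>^2\<close>, agreement on \<open>l\<close> coordinates costs \<open>1 / M^l\<close> in
  number and gains \<open>(1 / (1 - p)) ^ (l choose 2)\<close> in probability.\<close>

lemma no_transversal_bound:
  assumes p: "0 \<le> p" "p < 1" and M: "0 < M" and T: "0 < T"
    "(\<Sum>l\<in>{2..s}. real (s choose l) / real M ^ l * (1 / (1 - p)) ^ (l choose 2)) \<le> T"
    and w: "\<And>i. i < s \<Longrightarrow> card {v\<in>{0..<n}. w v = i} = M"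
  shows "bexp p (all_edges n)
      (\<lambda>E. of_bool (\<not> (\<exists>x. (\<forall>i<s. x i \<in> {0..<n} \<and> w (x i) = i) \<and> stable_set E (x ` {..<s}))))
    \<le> exp (- 1 / (2 * T))"
proof -
  define q where "q = 1 - p"
  have q: "0 < q" "q \<le> 1" using p by (auto simp: q_def)
  define W where "W i = {v\<in>{0..<n}. w v = i}" for i
  define X where "X = (PiE {..<s} W)"
  define A where "A x = pairs (x ` {..<s})" for x :: "nat \<Rightarrow> nat"
  define \<mu> where "\<mu> = real M ^ s * q ^ (s choose 2)"
  have W: "finite (W i)" "i < s \<Longrightarrow> card (W i) = M" for i using w by (auto simp: W_def)
  have finX: "finite X" unfolding X_def using W by (intro finite_PiE) auto
  have cardX: "card X = M ^ s" unfolding X_def using W by (simp add: card_PiE)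
  have x: "x i < n" "w (x i) = i" if "x \<in> X" "i < s" for x i
    using that by (auto simp: X_def W_def PiE_iff)
  have inj: "inj_on x {..<s}" if "x \<in> X" for x
    using x(2)[OF that] by (metis inj_onI lessThan_iff)
  have cardA: "card (A x) = s choose 2" if "x \<in> X" for x
    using inj[OF that] by (simp add: A_def card_pairs card_image)
  have A: "A x \<subseteq> all_edges n" if "x \<in> X" for x
    using x(1)[OF that] by (force simp: A_def all_edges_eq_pairs pairs_def)
  define agree where "agree x y = {i\<in>{..<s}. x i = y i}" for x y :: "nat \<Rightarrow> nat"
  have inter: "card (A x \<inter> A y) = card (agree x y) choose 2" if "x \<in> X" "y \<in> X" for x y
  proof -
    \<comment> \<open>The blocks are fibres of \<open>w\<close>, so a common vertex has the same
      index in both transversals.\<close>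
    have "x ` {..<s} \<inter> y ` {..<s} = x ` agree x y"
    proof
      show "x ` {..<s} \<inter> y ` {..<s} \<subseteq> x ` agree x y"
      proof
        fix v assume "v \<in> x ` {..<s} \<inter> y ` {..<s}"
        then obtain i j where ij: "i < s" "j < s" "v = x i" "v = y j" by auto
        then have "i = j" using x(2) that by metis
        then have "i \<in> agree x y" using ij by (simp add: agree_def)
        then show "v \<in> x ` agree x y" using ij by blast
      qed
      show "x ` agree x y \<subseteq> x ` {..<s} \<inter> y ` {..<s}"
      proof
        fix v assume "v \<in> x ` agree x y"
        then obtain i where "i < s" "x i = y i" "v = x i" by (auto simp: agree_def)
        then show "v \<in> x ` {..<s} \<inter> y ` {..<s}" by (metis IntI image_eqI lessThan_iff)
      qed
    qed
    then have "A x \<inter> A y = pairs (x ` agree x y)" by (auto simp: A_def pairs_def)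
    moreover have "inj_on x (agree x y)"
      using inj[OF that(1)] by (rule inj_on_subset) (auto simp: agree_def)
    moreover have "finite (agree x y)" by (simp add: agree_def)
    ultimately show ?thesis by (simp add: card_pairs card_image)
  qed
  have union: "q ^ card (A x \<union> A y) = q ^ (2 * (s choose 2)) * (1 / q) ^ (card (agree x y) choose 2)"
    if "x \<in> X" "y \<in> X" for x y
  proof -
    have "finite (A x)" "finite (A y)" unfolding A_def by (intro finite_pairs finite_imageI finite_lessThan)+
    from card_Un_Int[OF this] have "card (A x \<union> A y) + (card (agree x y) choose 2) = 2 * (s choose 2)"
      using inter[OF that] cardA that by simp
    then have "q ^ (2 * (s choose 2)) = q ^ card (A x \<union> A y) * q ^ (card (agree x y) choose 2)"
      by (metis power_add)
    then show ?thesis using q by (simp add: power_one_over)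
  qed
  let ?L = "{L\<in>Pow {..<s}. 2 \<le> card L}"
  \<comment> \<open>A common edge needs two common vertices, so overlaps start at 2; the value 0
    below that allows summation over the whole power set.\<close>
  let ?g = "\<lambda>l. if 2 \<le> l then 1 / real M ^ l * (1 / q) ^ (l choose 2) else 0"
  have inner: "(\<Sum>y\<in>{y\<in>X. A x \<inter> A y \<noteq> {}}. q ^ card (A x \<union> A y)) \<le> \<mu> * q ^ (s choose 2) * T"
    if xX: "x \<in> X" for x
  proof -
    have "(\<Sum>y\<in>{y\<in>X. A x \<inter> A y \<noteq> {}}. q ^ card (A x \<union> A y))
        = (\<Sum>y\<in>{y\<in>X. A x \<inter> A y \<noteq> {}}. q ^ (2 * (s choose 2)) * (1 / q) ^ (card (agree x y) choose 2))"
      using union[OF xX] by (intro sum.cong) auto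
    also have "\<dots> \<le> (\<Sum>y\<in>{y\<in>X. 2 \<le> card (agree x y)}. q ^ (2 * (s choose 2)) * (1 / q) ^ (card (agree x y) choose 2))"
    proof (rule sum_mono2)
      show "{y\<in>X. A x \<inter> A y \<noteq> {}} \<subseteq> {y\<in>X. 2 \<le> card (agree x y)}"
      proof clarify
        fix y assume y: "y \<in> X" "A x \<inter> A y \<noteq> {}"
        then have "0 < card (A x \<inter> A y)" by (auto simp: card_gt_0_iff A_def finite_pairs)
        then show "2 \<le> card (agree x y)" using inter[OF xX y(1)] by (simp add: zero_less_binomial_iff)
      qed
    qed (use finX q in auto)
    also have "\<dots> = (\<Sum>L\<in>?L. \<Sum>y\<in>{y\<in>{y\<in>X. 2 \<le> card (agree x y)}. agree x y = L}.
        q ^ (2 * (s choose 2)) * (1 / q) ^ (card (agree x y) choose 2))"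
      using finX by (intro sum.group[symmetric]) (auto simp: agree_def)
    also have "\<dots> \<le> (\<Sum>L\<in>?L. q ^ (2 * (s choose 2)) * (real M ^ s * ?g (card L)))"
    proof (rule sum_mono)
      fix L assume L: "L \<in> ?L"
      have "(\<Sum>y\<in>{y\<in>{y\<in>X. 2 \<le> card (agree x y)}. agree x y = L}.
          q ^ (2 * (s choose 2)) * (1 / q) ^ (card (agree x y) choose 2))
        = real (card {y\<in>{y\<in>X. 2 \<le> card (agree x y)}. agree x y = L}) *
          (q ^ (2 * (s choose 2)) * (1 / q) ^ (card L choose 2))"
        by simp
      also have "\<dots> \<le> real M ^ (s - card L) * (q ^ (2 * (s choose 2)) * (1 / q) ^ (card L choose 2))"
      proof (rule mult_right_mono)
        have "card {y\<in>{y\<in>X. 2 \<le> card (agree x y)}. agree x y = L} \<le> card {y\<in>X. agree x y = L}"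
          using finX by (intro card_mono) auto
        also have "\<dots> \<le> M ^ (s - card L)"
          using card_PiE_agree[of x s W M L] xX W L by (simp add: X_def agree_def)
        finally show "real (card {y\<in>{y\<in>X. 2 \<le> card (agree x y)}. agree x y = L}) \<le> real M ^ (s - card L)"
          unfolding of_nat_power[symmetric] by (rule of_nat_mono)
      qed (use q in auto)
      also have "real M ^ (s - card L) = real M ^ s * (1 / real M ^ card L)"
        using M L card_mono[of "{..<s}" L] by (simp add: power_diff)
      finally show "(\<Sum>y\<in>{y\<in>{y\<in>X. 2 \<le> card (agree x y)}. agree x y = L}.
          q ^ (2 * (s choose 2)) * (1 / q) ^ (card (agree x y) choose 2))
        \<le> q ^ (2 * (s choose 2)) * (real M ^ s * ?g (card L))"
        using L by (simp add: mult_ac)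
    qed
    also have "\<dots> = \<mu> * q ^ (s choose 2) * (\<Sum>L\<in>?L. ?g (card L))"
      by (simp add: \<mu>_def sum_distrib_left mult_ac power_add mult_2)
    also have "(\<Sum>L\<in>?L. ?g (card L)) = (\<Sum>L\<in>Pow {..<s}. ?g (card L))"
      by (intro sum.mono_neutral_left) auto
    also have "\<dots> = (\<Sum>l\<le>s. real (s choose l) * ?g l)"
      by (simp add: sum_Pow_card[of "{..<s}" ?g])
    also have "\<dots> = (\<Sum>l\<in>{2..s}. real (s choose l) * ?g l)"
      by (intro sum.mono_neutral_right) auto
    also have "\<dots> = (\<Sum>l\<in>{2..s}. real (s choose l) / real M ^ l * (1 / (1 - p)) ^ (l choose 2))"
      by (intro sum.cong) (auto simp: q_def)
    also have "\<mu> * q ^ (s choose 2) * \<dots> \<le> \<mu> * q ^ (s choose 2) * T"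
      using T q by (intro mult_left_mono) (auto simp: \<mu>_def)
    finally show ?thesis by simp
  qed
  have mu_pos: "0 < \<mu>" using M q by (simp add: \<mu>_def)
  have "bexp p (all_edges n)
      (\<lambda>E. of_bool (\<not> (\<exists>x. (\<forall>i<s. x i \<in> {0..<n} \<and> w (x i) = i) \<and> stable_set E (x ` {..<s}))))
    \<le> bexp p (all_edges n) (\<lambda>E. of_bool (\<forall>x\<in>X. E \<inter> A x \<noteq> {}))"
  proof (rule bexp_mono)
    fix E assume E: "E \<subseteq> all_edges n"
    have "\<forall>x\<in>X. E \<inter> A x \<noteq> {}"
      if no: "\<not> (\<exists>x. (\<forall>i<s. x i \<in> {0..<n} \<and> w (x i) = i) \<and> stable_set E (x ` {..<s}))"
    proof
      fix y assume y: "y \<in> X"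
      then have "\<forall>i<s. y i \<in> {0..<n} \<and> w (y i) = i" using x[OF y] by simp
      then have "\<not> stable_set E (y ` {..<s})" using no by blast
      then show "E \<inter> A y \<noteq> {}" using stable_set_iff_pairs[OF E] by (simp add: A_def)
    qed
    then show "of_bool (\<not> (\<exists>x. (\<forall>i<s. x i \<in> {0..<n} \<and> w (x i) = i) \<and> stable_set E (x ` {..<s})))
        \<le> (of_bool (\<forall>x\<in>X. E \<inter> A x \<noteq> {}) :: real)" by auto
  qed (use p in auto)
  \<comment> \<open>The bound on the dependent pairs carries the factor \<open>\<mu>^2\<close>, so
    \<open>\<mu>\<close> cancels and only \<open>T\<close> remains.\<close>
  also have "\<dots> \<le> exp (- \<mu>\<^sup>2 / (2 * (\<mu>\<^sup>2 * T)))"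
  proof (rule janson_inequality)
    show "\<mu> = (\<Sum>x\<in>X. (1 - p) ^ card (A x))"
      using cardA cardX by (simp add: \<mu>_def q_def)
    have "(\<Sum>x\<in>X. \<Sum>y\<in>{y\<in>X. A x \<inter> A y \<noteq> {}}. q ^ card (A x \<union> A y))
        \<le> (\<Sum>x\<in>X. \<mu> * q ^ (s choose 2) * T)"
      by (intro sum_mono inner)
    also have "\<dots> = \<mu>\<^sup>2 * T" using cardX by (simp add: \<mu>_def power2_eq_square)
    finally show "(\<Sum>x\<in>X. \<Sum>y\<in>{y\<in>X. A x \<inter> A y \<noteq> {}}. (1 - p) ^ card (A x \<union> A y)) \<le> \<mu>\<^sup>2 * T"
      by (simp add: q_def)
  qed (use finX p A mu_pos T in \<open>auto simp: all_edges_eq_pairs finite_pairs\<close>)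
  also have "- \<mu>\<^sup>2 / (2 * (\<mu>\<^sup>2 * T)) = - 1 / (2 * T)" using mu_pos by simp
  finally show ?thesis .
qed

text \<open>Block families are encoded as maps into \<open>{..s}\<close>, so there are at most
  \<open>Suc s ^ n\<close> of them in the union bound.\<close>

lemma no_independent_transversals_bound:
  assumes p: "0 \<le> p" "p < 1" and M: "0 < M" and T: "0 < T"
    "(\<Sum>l\<in>{2..s}. real (s choose l) / real M ^ l * (1 / (1 - p)) ^ (l choose 2)) \<le> T"
  shows "bexp p (all_edges n) (\<lambda>E. of_bool (\<not> has_independent_transversals n E s M))
    \<le> real (Suc s) ^ n * exp (- 1 / (2 * T))"
proof -
  let ?X = "{w \<in> {0..<n} \<rightarrow>\<^sub>E {..s}. \<forall>i<s. card {v\<in>{0..<n}. w v = i} = M}"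
  have fin: "finite ({0..<n} \<rightarrow>\<^sub>E {..s})" by (intro finite_PiE) auto
  then have finX: "finite ?X" by simp
  have p1: "p \<le> 1" using p by simp
  have "bexp p (all_edges n) (\<lambda>E. of_bool (\<not> has_independent_transversals n E s M))
    \<le> (\<Sum>w\<in>?X. bexp p (all_edges n)
      (\<lambda>E. of_bool (\<not> (\<exists>x. (\<forall>i<s. x i \<in> {0..<n} \<and> w (x i) = i) \<and> stable_set E (x ` {..<s})))))"
    by (rule bexp_union_bound[OF p(1) p1 finX]) (simp only: has_independent_transversals_def, blast)
  also have "\<dots> \<le> (\<Sum>w\<in>?X. exp (- 1 / (2 * T)))"
    by (rule sum_mono, rule no_transversal_bound[OF p M T]) blast
  also have "\<dots> = real (card ?X) * exp (- 1 / (2 * T))" by simp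
  also have "\<dots> \<le> real (Suc s) ^ n * exp (- 1 / (2 * T))"
  proof (rule mult_right_mono)
    have "card ?X \<le> card ({0..<n} \<rightarrow>\<^sub>E {..s})" using fin by (intro card_mono) auto
    also have "\<dots> = Suc s ^ n" by (simp add: card_PiE)
    finally show "real (card ?X) \<le> real (Suc s) ^ n"
      unfolding of_nat_power[symmetric] by (rule of_nat_mono)
  qed simp
  finally show ?thesis .
qed

section \<open>Numerical estimates\<close>

text \<open>A single term of the exponential series at \<open>l\<close>.\<close>

lemma power_self_le_exp_fact: "real l ^ l \<le> exp (real l) * fact l"
proof -
  have "(\<Sum>k\<in>{l}. inverse (fact k) * real l ^ k) \<le> (\<Sum>k. inverse (fact k) * real l ^ k)"
    by (rule sum_le_suminf) (use summable_exp[of "real l"] in auto)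
  then show ?thesis by (simp add: exp_def scaleR_conv_of_real field_simps)
qed

lemma binomial_le_exp_power:
  assumes "0 < l"
  shows "real (s choose l) \<le> (exp 1 * real s / real l) ^ l"
proof -
  have "real ((s choose l) * fact l) \<le> real (s ^ l)"
    using binomial_fact_pow by (rule of_nat_mono)
  then have "real (s choose l) * real l ^ l * fact l \<le> real s ^ l * (exp (real l) * fact l)"
    using mult_mono[OF _ power_self_le_exp_fact[of l], of "real (s choose l) * fact l" "real s ^ l"]
    by (simp add: algebra_simps)
  then have "real (s choose l) * real l ^ l \<le> real s ^ l * exp (real l)"
    by simp
  then have "real (s choose l) \<le> real s ^ l * exp 1 ^ l / real l ^ l"
    using assms by (simp add: pos_le_divide_eq exp_of_nat_mult[symmetric])
  then show ?thesis by (simp add: power_mult_distrib power_divide mult.commute)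
qed

text \<open>Written as an \<open>l\<close>-th power so that it merges with
  \<open>binomial_le_exp_power\<close> and only the base has to be estimated.\<close>

lemma exp_mult_choose_two:
  "exp L ^ (l choose 2) = exp (L * (real l - 1) / 2) ^ l"
proof -
  have eq: "real (l choose 2) = real l * (real l - 1) / 2"
    by (cases l) (simp_all add: choose_two real_of_nat_div algebra_simps)
  show ?thesis unfolding exp_of_nat_mult[symmetric] eq by (simp add: mult_ac)
qed

text \<open>The number \<open>j\<close> separates the two ways of bounding the Janson terms of overlap \<open>l \<ge> 3\<close>.\<close>

locale dense_regime =
  fixes n j :: nat and p K \<eta> L \<nu> x z :: real and s a M D :: nat
  assumes p: "0 < p" "p < 1" and K: "1 / (1 - p) \<le> K"
    and \<eta>: "0 < \<eta>" "\<eta> \<le> 1 / 8"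
    and z: "z = real n powr (1/4)"
    and dense: "1 \<le> p * z" "256 * K * ln (real n) ^ 9 \<le> p ^ 4 * real n"
    and L: "L = - ln (1 - p)" and lam: "\<nu> = ln (real n * p)" and x: "x = 2 * \<nu> / L"
    and s: "s = nat \<lfloor>(1 - \<eta>) * x\<rfloor>" and a: "a = nat \<lfloor>(1 + \<eta>) * x\<rfloor>"
    and M: "M = nat \<lceil>real n / (2 * ln (real n) ^ 2 * real s)\<rceil>"
    and D: "D = nat \<lfloor>4 * (real n / ln (real n) ^ 2) * p\<rfloor>"
    and j: "8 \<le> \<eta> * real j"
    and ell: "1 \<le> ln (real n)"
    and large_m: "2 * ln n * z + 8 * ln n ^ 2 * z\<^sup>2 \<le> n / (2 * ln n ^ 2)"
    and large_x: "K \<le> \<eta> * (3 / 2 * ln n)"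
    and large_rest: "16 / ln n + 16 * ln n ^ 2 / z\<^sup>2 + 4 * ln n / z ^ 3 \<le> \<eta>"
    and large_s: "2 * ln n * z + 1 \<le> n"
    and large_mp: "3 * ln n \<le> z ^ 3 / ln n ^ 2"
    and large_alpha: "exp 1 * K\<^sup>2 * exp (- (3 / 4 * \<eta> * ln n)) \<le> 1"
    and large_rho: "8 * ln n ^ 4 / z\<^sup>2 \<le> 1"
    and large_T: "2 * ln n * z * (K ^ (j choose 2) * (8 * ln n ^ 4 / z\<^sup>2) ^ 3 + exp (- 3 * ln n)) \<le> 1 / (8 * n * ln n)"
    and large_B1: "16 * exp 1 * ln n ^ 3 \<le> exp (3 / 8 * \<eta> * ln n)"
    and large_B2: "8 * exp 1 * ln n ^ 4 / z \<le> exp (- (ln n / 16))"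
begin

section \<open>Sizes of the parameters\<close>

definition m :: real where "m = n / ln n ^ 2"

lemma n_pos: "0 < n" "1 < real n"
proof -
  have "n \<noteq> 0"
  proof
    assume "n = 0"
    then show False using ell by simp
  qed
  moreover have "n \<noteq> 1" using ell by auto
  ultimately show "0 < n" "1 < real n" by auto
qed

lemma z_facts: "0 < z" "z ^ 4 = n" "ln z = ln n / 4" "exp (ln n / 4) = z"
proof -
  show "0 < z" using n_pos by (simp add: z)
  have "z ^ 4 = z powr 4" using \<open>0 < z\<close> by (simp add: powr_numeral)
  also have "\<dots> = n" using n_pos by (simp add: z powr_powr)
  finally show "z ^ 4 = n" .
  show ln: "ln z = ln n / 4" using n_pos by (simp add: z ln_powr)
  show "exp (ln n / 4) = z" using \<open>0 < z\<close> by (simp flip: ln)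
qed

lemma p_inv: "1 / p \<le> z"
  using dense(1) p by (simp add: pos_divide_le_eq mult.commute)

lemma np_ge: "z ^ 3 \<le> n * p"
proof -
  have "z ^ 3 * 1 \<le> z ^ 3 * (p * z)"
    using dense(1) z_facts(1) by (intro mult_left_mono) auto
  also have "\<dots> = z ^ 4 * p" by (simp add: power_numeral_reduce mult_ac)
  finally show ?thesis using z_facts by simp
qed

text \<open>The constant \<open>3 / 4\<close> reflects \<open>n * p \<ge> z ^ 3\<close>, that is,
  \<open>p\<close> is at least \<open>n\<close> to the power \<open>- 1 / 4\<close>.\<close>

lemma lam_bounds: "3 / 4 * ln n \<le> \<nu>" "\<nu> \<le> ln n" "3 / 4 \<le> \<nu>" "exp \<nu> = n * p"
proof -
  have np: "0 < n * p" using n_pos p by simp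
  then show "exp \<nu> = n * p" by (simp add: lam)
  have "ln (z ^ 3) \<le> \<nu>" unfolding lam using np_ge z_facts np by (subst ln_le_cancel_iff) auto
  moreover have "ln (z ^ 3) = 3 / 4 * ln n" using z_facts by (simp add: ln_realpow)
  ultimately show *: "3 / 4 * ln n \<le> \<nu>" by simp
  then show "3 / 4 \<le> \<nu>" using ell by linarith
  show "\<nu> \<le> ln n" unfolding lam using np p n_pos by (subst ln_le_cancel_iff) auto
qed

lemma L_bounds: "p \<le> L" "L \<le> K * p" "0 < L" "exp L \<le> K" "exp L = 1 / (1 - p)" "1 \<le> K"
proof -
  show "p \<le> L" using ln_le_minus_one[of "1 - p"] p by (simp add: L)
  then show "0 < L" using p by simp
  show e: "exp L = 1 / (1 - p)" using p by (simp add: L exp_minus field_simps)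
  then show eK: "exp L \<le> K" using K by simp
  have "L = ln (1 / (1 - p))" using p by (simp add: L ln_div)
  also have "\<dots> \<le> 1 / (1 - p) - 1" using p by (intro ln_le_minus_one) simp
  also have "\<dots> = 1 / (1 - p) * p" using p by (simp add: field_simps)
  also have "\<dots> \<le> K * p" using K p by (intro mult_right_mono) auto
  finally show "L \<le> K * p" .
  show "1 \<le> K" using eK \<open>0 < L\<close> by (meson less_eq_real_def one_less_exp_iff order_trans)
qed

lemma xL: "x * L = 2 * \<nu>"
  using L_bounds by (simp add: x)

text \<open>The bound \<open>1 \<le> \<eta> * x\<close> lets the rounding in \<open>s\<close> be
  absorbed into a second \<open>\<eta>\<close>.\<close>

lemma x_bounds: "x \<le> 2 * ln n / p" "x \<le> 2 * ln n * z" "1 \<le> \<eta> * x" "8 \<le> x"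
proof -
  show le: "x \<le> 2 * ln n / p"
    unfolding x using lam_bounds L_bounds p by (intro frac_le) auto
  have "2 * ln n * (1 / p) \<le> 2 * ln n * z" using p_inv ell by (intro mult_left_mono) auto
  then show "x \<le> 2 * ln n * z" using le by simp
  have "K \<le> \<eta> * (2 * \<nu>)"
    using large_x mult_left_mono[of "3 / 2 * ln n" "2 * \<nu>" \<eta>] lam_bounds \<eta> by linarith
  moreover have "L \<le> K"
    using L_bounds p mult_left_mono[of p 1 K] by linarith
  ultimately have "L \<le> \<eta> * (2 * \<nu>)" by simp
  then show *: "1 \<le> \<eta> * x"
    using L_bounds by (simp add: x pos_le_divide_eq)
  have "0 \<le> x" using * \<eta> by (smt (verit) mult_nonneg_nonpos)
  then have "\<eta> * x \<le> 1 / 8 * x" using \<eta> by (intro mult_right_mono) auto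
  then show "8 \<le> x" using * by linarith
qed

lemma s_bounds: "real s \<le> (1 - \<eta>) * x" "(1 - 2 * \<eta>) * x \<le> s" "6 \<le> real s" "real s \<le> x"
proof -
  have eta: "\<eta> * x \<le> 1 / 8 * x" "0 \<le> \<eta> * x" using \<eta> x_bounds by (auto intro!: mult_right_mono)
  have nonneg: "0 \<le> (1 - \<eta>) * x" using \<eta> x_bounds by simp
  show *: "real s \<le> (1 - \<eta>) * x" using nonneg by (simp add: s)
  then show "real s \<le> x" using eta by (simp add: algebra_simps)
  have "(1 - \<eta>) * x - 1 \<le> real s" using nonneg by (simp add: s)
  then show "(1 - 2 * \<eta>) * x \<le> s" using x_bounds by (simp add: algebra_simps)
  moreover have "(1 - 2 * \<eta>) * x = x - 2 * (\<eta> * x)" by (simp add: algebra_simps)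
  ultimately show "6 \<le> real s" using eta x_bounds by linarith
qed

lemma a_bounds: "real a \<le> (1 + \<eta>) * x" "(1 + \<eta>) * x < real a + 1" "real a \<le> 2 * x"
proof -
  have eta: "\<eta> * x \<le> 1 / 8 * x" "0 \<le> \<eta> * x" using \<eta> x_bounds by (auto intro!: mult_right_mono)
  have nonneg: "0 \<le> (1 + \<eta>) * x" using \<eta> x_bounds by simp
  show *: "real a \<le> (1 + \<eta>) * x" using nonneg by (simp add: a)
  moreover have "(1 + \<eta>) * x = x + \<eta> * x" by (simp add: algebra_simps)
  ultimately show "real a \<le> 2 * x" using eta x_bounds by linarith
  show "(1 + \<eta>) * x < real a + 1" using nonneg by (simp add: a)
qed

lemma m_pos: "0 < m" using n_pos ell by (simp add: m_def)

lemma M_bounds: "m / (2 * s) \<le> M" "M \<le> m / (2 * s) + 1" "0 < M"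
proof -
  have eq: "real n / (2 * ln (real n) ^ 2 * real s) = m / (2 * s)" by (simp add: m_def)
  have pos: "0 < m / (2 * s)" using m_pos s_bounds by simp
  show "m / (2 * s) \<le> M" "M \<le> m / (2 * s) + 1" unfolding M eq using pos by linarith+
  then show "0 < M" using pos by linarith
qed

text \<open>The \<open>s\<close> blocks use about half of \<open>m\<close>; the other half pays for
  the ceiling in \<open>M\<close> and the overshoot \<open>a\<close> per block, both of lower
  order.\<close>

lemma size_condition: "real (s * (M + a)) \<le> m"
proof -
  have "real (s * (M + a)) \<le> s * (m / (2 * s) + 1 + a)"
    using M_bounds by (simp add: mult_left_mono)
  also have "\<dots> = m / 2 + s + s * a" using s_bounds by (simp add: algebra_simps)
  also have "\<dots> \<le> m / 2 + 2 * ln n * z + 8 * ln n ^ 2 * z\<^sup>2"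
  proof -
    have "real s * a \<le> (2 * ln n * z) * (4 * ln n * z)"
      using s_bounds a_bounds x_bounds ell z_facts(1) by (intro mult_mono) auto
    then show ?thesis using s_bounds x_bounds by (simp add: power2_eq_square mult_ac)
  qed
  also have "\<dots> \<le> m" using large_m by (simp add: m_def)
  finally show ?thesis .
qed

lemma D_bound: "4 * m * p \<le> real D + 1" "real D \<le> 4 * m * p"
proof -
  have "0 \<le> 4 * m * p" using m_pos p by simp
  then show "4 * m * p \<le> real D + 1" "real D \<le> 4 * m * p" unfolding D m_def[symmetric] by linarith+
qed

text \<open>The quotient \<open>(1 + \<eta>) / (1 - 2 * \<eta>)\<close> accounts for
  \<open>6 * \<eta>\<close>, and the colours of the greedy remainder for the last
  \<open>\<eta>\<close>.\<close>

lemma ratio_bound: "real a / s + a * (D + a + 1) / n \<le> 1 + 7 * \<eta>"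
proof -
  have "(1 + \<eta>) * x \<le> (1 + 6 * \<eta>) * ((1 - 2 * \<eta>) * x)"
  proof -
    have "1 + \<eta> \<le> (1 + 6 * \<eta>) * (1 - 2 * \<eta>)"
      using \<eta> mult_left_mono[of \<eta> "1/8" \<eta>] by (simp add: algebra_simps)
    then show ?thesis using x_bounds by (simp add: mult.assoc[symmetric] mult_right_mono)
  qed
  also have "\<dots> \<le> (1 + 6 * \<eta>) * s" using s_bounds \<eta> by (intro mult_left_mono) auto
  finally have "a \<le> (1 + 6 * \<eta>) * s" using a_bounds by linarith
  then have 1: "real a / s \<le> 1 + 6 * \<eta>" using s_bounds by (simp add: pos_divide_le_eq)
  have a4: "a \<le> 4 * ln n / p" "a \<le> 4 * ln n * z" using a_bounds x_bounds by auto
  have "a * (D + a + 1) = a * real D + a * a + a" by (simp add: algebra_simps)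
  also have "\<dots> \<le> 16 * n / ln n + 16 * ln n ^ 2 * z\<^sup>2 + 4 * ln n * z"
  proof (intro add_mono)
    have "a * real D \<le> (4 * ln n / p) * (4 * m * p)"
      using a4 D_bound by (intro mult_mono) (use p ell in auto)
    also have "\<dots> = 16 * n / ln n" using p ell by (simp add: m_def power2_eq_square)
    finally show "a * real D \<le> 16 * n / ln n" .
    have "real a * a \<le> (4 * ln n * z) * (4 * ln n * z)"
      using a4 ell z_facts by (intro mult_mono) auto
    then show "real (a * a) \<le> 16 * ln n ^ 2 * z\<^sup>2" by (simp add: power2_eq_square mult_ac)
  qed (use a4 in simp)
  finally have "a * (D + a + 1) / n \<le> (16 * n / ln n + 16 * ln n ^ 2 * z\<^sup>2 + 4 * ln n * z) / n"
    by (intro divide_right_mono) auto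
  also have "\<dots> = 16 / ln n + 16 * ln n ^ 2 * z\<^sup>2 / z ^ 4 + 4 * ln n * z / z ^ 4"
    using n_pos by (simp add: add_divide_distrib z_facts(2))
  also have "\<dots> = 16 / ln n + 16 * ln n ^ 2 / z\<^sup>2 + 4 * ln n / z ^ 3"
    using z_facts(1) by (simp add: field_simps power_numeral_reduce)
  also have "\<dots> \<le> \<eta>" by (rule large_rest)
  finally show ?thesis using 1 by linarith
qed

lemma s_less_n: "real (Suc s) \<le> n"
  using s_bounds x_bounds large_s by simp

text \<open>Makes the failure bound for local degeneracy at most \<open>(1 + n^-3)^n - 1\<close>,
  which tends to 0.\<close>

lemma exp_mp: "exp (- (m * p)) \<le> exp (- 3 * ln n)"
proof -
  have "z ^ 3 / ln n ^ 2 \<le> n * p / ln n ^ 2"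
    using np_ge ell by (intro divide_right_mono) auto
  then show ?thesis using large_mp by (simp add: m_def)
qed

text \<open>Per vertex there are about \<open>exp 1 * n / t\<close> choices, and the missing edges
  cost \<open>(n * p)\<close> to the power \<open>- (1 + \<eta>)\<close>. With \<open>x\<close> of
  order \<open>\<nu> / L\<close> the main factors cancel up to constants in \<open>K\<close>,
  leaving \<open>exp (- (\<eta> * \<nu>))\<close>.\<close>

lemma alpha_bound:
  "real (n choose Suc a) * (1 - p) ^ (Suc a choose 2) \<le> exp 1 * K\<^sup>2 * exp (- (3 / 4 * \<eta> * ln n))"
    (is "_ \<le> ?b")
proof -
  define t where "t = Suc a"
  have t: "(1 + \<eta>) * x \<le> t" "x \<le> t" "0 < t"
    using a_bounds x_bounds \<eta> by (auto simp: t_def algebra_simps intro: order_trans[of _ "x + \<eta> * x"])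
  have "1 - p = exp (- L)" using p by (simp add: L)
  then have "real (n choose t) * (1 - p) ^ (t choose 2)
      \<le> (exp 1 * n / t) ^ t * exp (- L * (real t - 1) / 2) ^ t"
    using binomial_le_exp_power[OF t(3), of n]
    by (simp only: exp_mult_choose_two) (intro mult_right_mono, auto)
  also have "\<dots> = (exp 1 * n / t * exp (- L * (real t - 1) / 2)) ^ t"
    by (rule power_mult_distrib[symmetric])
  also have "\<dots> \<le> ?b ^ t"
  proof (rule power_mono)
    have "exp 1 * n / t * exp (- L * (real t - 1) / 2) \<le> exp 1 * n / x * (exp L * exp (- ((1 + \<eta>) * \<nu>)))"
    proof (intro mult_mono divide_left_mono)
      have "L * ((1 + \<eta>) * x) \<le> L * t" using t L_bounds by (intro mult_left_mono) auto
      moreover have "L * ((1 + \<eta>) * x) = (1 + \<eta>) * (x * L)" by simp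
      ultimately have "2 * ((1 + \<eta>) * \<nu>) \<le> L * t" unfolding xL by simp
      moreover have "- L * (real t - 1) / 2 = L / 2 - L * t / 2" by (simp add: field_simps)
      ultimately have "- L * (real t - 1) / 2 \<le> L - (1 + \<eta>) * \<nu>" using L_bounds by linarith
      then show "exp (- L * (real t - 1) / 2) \<le> exp L * exp (- ((1 + \<eta>) * \<nu>))"
        by (simp flip: exp_add)
    qed (use t x_bounds in auto)
    also have "exp (- ((1 + \<eta>) * \<nu>)) = 1 / (n * p) * exp (- (\<eta> * \<nu>))"
    proof -
      have "- ((1 + \<eta>) * \<nu>) = - \<nu> + - (\<eta> * \<nu>)" by (simp add: algebra_simps)
      then show ?thesis
        unfolding lam_bounds(4)[symmetric] by (simp only: exp_add exp_minus[of \<nu>] inverse_eq_divide)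
    qed
    also have "exp 1 * n / x * (exp L * (1 / (n * p) * exp (- (\<eta> * \<nu>))))
        = exp 1 * (L / p) * exp L * exp (- (\<eta> * \<nu>)) / (2 * \<nu>)"
      using n_pos p L_bounds lam_bounds by (simp add: x field_simps)
    also have "\<dots> \<le> exp 1 * (L / p) * exp L * exp (- (\<eta> * \<nu>)) / 1"
      using lam_bounds L_bounds p by (intro divide_left_mono) auto
    also have "\<dots> \<le> exp 1 * K * K * exp (- (3 / 4 * \<eta> * ln n)) / 1"
    proof (intro divide_right_mono mult_mono)
      show "L / p \<le> K" using L_bounds p by (simp add: pos_divide_le_eq)
      show "exp (- (\<eta> * \<nu>)) \<le> exp (- (3 / 4 * \<eta> * ln n))"
        using mult_left_mono[OF lam_bounds(1), of \<eta>] \<eta> by simp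
    qed (use L_bounds p in auto)
    finally show "exp 1 * n / t * exp (- L * (real t - 1) / 2) \<le> ?b" by (simp add: power2_eq_square mult_ac)
  qed simp
  \<comment> \<open>The base is at most 1, and its first power already tends to 0.\<close>
  also have "\<dots> \<le> ?b ^ 1" using large_alpha t L_bounds by (intro power_decreasing) auto
  finally show ?thesis by (simp add: t_def)
qed

section \<open>The sum over overlaps in Janson's inequality\<close>

lemma rho_bound: "real s / M \<le> 8 * ln n ^ 4 / z\<^sup>2"
proof -
  have "real s / M \<le> s / (m / (2 * s))"
    using M_bounds m_pos s_bounds by (intro divide_left_mono) auto
  also have "\<dots> = 2 * (real s * s) / m" using m_pos s_bounds by (simp add: field_simps)
  also have "\<dots> \<le> 2 * ((2 * ln n * z) * (2 * ln n * z)) / m"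
    using s_bounds x_bounds m_pos ell z_facts(1) by (intro divide_right_mono mult_left_mono mult_mono) auto
  also have "\<dots> = 8 * ln n ^ 4 * z\<^sup>2 / z ^ 4"
    using ell z_facts(1) by (simp add: m_def z_facts(2)[symmetric] field_simps power_numeral_reduce)
  also have "\<dots> = 8 * ln n ^ 4 / z\<^sup>2" using z_facts(1) by (simp add: field_simps power_numeral_reduce)
  finally show ?thesis .
qed

text \<open>The term of \<open>no_transversal_bound\<close> for pairs of transversals agreeing on
  \<open>l\<close> coordinates, relative to \<open>\<mu>^2\<close>.\<close>

definition overlap :: "nat \<Rightarrow> real" where
  "overlap l = real (s choose l) / real M ^ l * (1 / (1 - p)) ^ (l choose 2)"

text \<open>The critical term, of order \<open>s ^ 4 / m ^ 2\<close>. It fits the budget exactly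
  because \<open>p ^ 4 * n\<close> is at least \<open>256 * K * ln n ^ 9\<close>, which is where the
  lower bound on \<open>p\<close> enters.\<close>

lemma overlap_2: "overlap 2 \<le> 1 / (8 * n * ln n)"
proof -
  have "overlap 2 \<le> (real s ^ 2 / 2) / (m / (2 * s)) ^ 2 * K"
    unfolding overlap_def
  proof (intro mult_mono frac_le power_mono)
    have "2 * (s choose 2) \<le> s * (s - 1)"
      unfolding choose_two using div_times_less_eq_dividend[of "s * (s - 1)" 2] by simp
    also have "\<dots> \<le> s * s" by simp
    finally have "real (2 * (s choose 2)) \<le> real (s * s)" by (rule of_nat_mono)
    then show "real (s choose 2) \<le> real s ^ 2 / 2" by (simp add: power2_eq_square)
  qed (use M_bounds m_pos s_bounds K p L_bounds in auto)
  also have "\<dots> = 2 * K * real s ^ 4 / m ^ 2" using s_bounds m_pos by (simp add: field_simps power_numeral_reduce)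
  also have "\<dots> \<le> 2 * K * (2 * ln n / p) ^ 4 / m ^ 2"
    using s_bounds x_bounds L_bounds by (intro divide_right_mono mult_left_mono power_mono) auto
  also have "\<dots> = 32 * K * ln n ^ 8 / (p ^ 4 * n) / n"
    using ell n_pos p by (simp add: m_def field_simps power_numeral_reduce)
  also have "\<dots> \<le> 32 * K * ln n ^ 8 / (256 * K * ln n ^ 9) / n"
    using dense(2) ell L_bounds n_pos p by (intro divide_right_mono divide_left_mono) auto
  also have "\<dots> = 1 / (8 * n * ln n)"
    using ell n_pos L_bounds by (simp add: field_simps power_numeral_reduce)
  finally show ?thesis .
qed

text \<open>For bounded \<open>l\<close> the factor from \<open>K\<close> is a constant, and the
  cube of \<open>s / M\<close> is of order \<open>n\<close> to the power \<open>- 3 / 2\<close> up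
  to logarithms, small enough even after summing over \<open>l\<close>.\<close>

lemma overlap_small:
  assumes "3 \<le> l" "l \<le> j"
  shows "overlap l \<le> K ^ (j choose 2) * (8 * ln n ^ 4 / z\<^sup>2) ^ 3"
proof -
  have "real (s choose l) \<le> real s ^ l"
  proof (cases "l \<le> s")
    case True
    then have "s choose l \<le> s ^ l" by (rule binomial_le_pow)
    then show ?thesis unfolding of_nat_power[symmetric] by (rule of_nat_mono)
  qed (simp add: binomial_eq_0)
  then have "overlap l \<le> real s ^ l / real M ^ l * K ^ (l choose 2)"
    unfolding overlap_def using K p by (intro mult_mono divide_right_mono power_mono) auto
  also have "\<dots> = (real s / M) ^ l * K ^ (l choose 2)" by (simp add: power_divide)
  also have "\<dots> \<le> (8 * ln n ^ 4 / z\<^sup>2) ^ 3 * K ^ (j choose 2)"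
  proof (intro mult_mono)
    have "(real s / M) ^ l \<le> (8 * ln n ^ 4 / z\<^sup>2) ^ l" using rho_bound by (intro power_mono) auto
    also have "\<dots> \<le> (8 * ln n ^ 4 / z\<^sup>2) ^ 3" using large_rho assms by (intro power_decreasing) auto
    finally show "(real s / M) ^ l \<le> (8 * ln n ^ 4 / z\<^sup>2) ^ 3" .
    show "K ^ (l choose 2) \<le> K ^ (j choose 2)"
      using L_bounds assms by (intro power_increasing binomial_right_mono) auto
  qed (use L_bounds in auto)
  finally show ?thesis by (simp add: mult.commute)
qed

text \<open>If \<open>s \<le> 4 * l\<close>, then \<open>s / l\<close> is bounded and
  \<open>l \<le> (1 - \<eta>) * x\<close> keeps the exponential below \<open>n * p\<close> to the
  power \<open>1 - \<eta>\<close>, while \<open>M\<close> is of order at least \<open>n * p\<close>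
  up to logarithms. If \<open>l\<close> is smaller, the exponential is at most \<open>z\<close>, and
  \<open>s / M\<close>, of order \<open>1 / z^2\<close> up to logarithms, outweighs it.\<close>

lemma overlap_base:
  assumes "0 < l" "l \<le> s"
  shows "exp 1 * s / l / M * exp (L * (real l - 1) / 2) \<le> exp (- (\<eta> * \<nu> / 2))"
proof (cases "s \<le> 4 * l")
  case True
  have sl: "real s / l \<le> 4" using assms True by (simp add: pos_divide_le_eq)
  have "exp 1 * s / l / M * exp (L * (real l - 1) / 2)
      = exp 1 * (s / l) * (1 / M) * exp (L * (real l - 1) / 2)" by simp
  also have "\<dots> \<le> exp 1 * 4 * (4 * ln n ^ 3 / (n * p)) * exp ((1 - \<eta>) * \<nu>)"
  proof (intro mult_mono)
    have "1 / M \<le> 1 / (m / (2 * s))"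
      using M_bounds m_pos s_bounds by (intro divide_left_mono) auto
    also have "\<dots> = 2 * s / m" by simp
    also have "\<dots> \<le> 2 * (2 * ln n / p) / m"
      using s_bounds x_bounds m_pos by (intro divide_right_mono mult_left_mono) auto
    also have "\<dots> = 4 * ln n ^ 3 / (n * p)"
      using ell n_pos p by (simp add: m_def field_simps power_numeral_reduce)
    finally show "1 / M \<le> 4 * ln n ^ 3 / (n * p)" .
    have "L * (real l - 1) \<le> L * ((1 - \<eta>) * x)"
      using s_bounds L_bounds assms by (intro mult_left_mono) auto
    also have "\<dots> = 2 * ((1 - \<eta>) * \<nu>)" using xL by (simp add: algebra_simps)
    finally show "exp (L * (real l - 1) / 2) \<le> exp ((1 - \<eta>) * \<nu>)" by simp
  qed (use sl ell p in auto)
  also have "exp ((1 - \<eta>) * \<nu>) = (n * p) * exp (- (\<eta> * \<nu>))"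
    unfolding lam_bounds(4)[symmetric] by (simp add: exp_add[symmetric] algebra_simps)
  also have "exp 1 * 4 * (4 * ln n ^ 3 / (n * p)) * ((n * p) * exp (- (\<eta> * \<nu>)))
      = 16 * exp 1 * ln n ^ 3 * exp (- (\<eta> * \<nu>))" using n_pos p by simp
  also have "\<dots> \<le> exp (\<eta> * \<nu> / 2) * exp (- (\<eta> * \<nu>))"
  proof (rule mult_right_mono)
    have "exp (3 / 8 * \<eta> * ln n) \<le> exp (\<eta> * \<nu> / 2)"
      using mult_left_mono[OF lam_bounds(1), of \<eta>] \<eta> by simp
    then show "16 * exp 1 * ln n ^ 3 \<le> exp (\<eta> * \<nu> / 2)" using large_B1 by linarith
  qed simp
  also have "\<dots> = exp (- (\<eta> * \<nu> / 2))" by (simp flip: exp_add)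
  finally show ?thesis .
next
  case False
  have "exp 1 * s / l / M * exp (L * (real l - 1) / 2)
      = exp 1 * (1 / l) * (s / M) * exp (L * (real l - 1) / 2)" by simp
  also have "\<dots> \<le> exp 1 * 1 * (8 * ln n ^ 4 / z\<^sup>2) * z"
  proof (intro mult_mono rho_bound)
    have "L * (real l - 1) \<le> L * (x / 4)"
      using False s_bounds L_bounds by (intro mult_left_mono) auto
    also have "\<dots> = \<nu> / 2" using xL by (simp add: algebra_simps)
    also have "\<dots> \<le> ln n / 2" using lam_bounds by simp
    finally have "exp (L * (real l - 1) / 2) \<le> exp (ln n / 4)" by simp
    then show "exp (L * (real l - 1) / 2) \<le> z" using z_facts by simp
  qed (use assms in auto)
  also have "\<dots> = 8 * exp 1 * ln n ^ 4 / z" using z_facts(1) by (simp add: power2_eq_square)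
  also have "\<dots> \<le> exp (- (ln n / 16))" by (rule large_B2)
  also have "\<dots> \<le> exp (- (\<eta> * \<nu> / 2))"
  proof -
    have "\<eta> * \<nu> \<le> 1 / 8 * ln n" using \<eta> lam_bounds by (intro mult_mono) auto
    then show ?thesis by simp
  qed
  finally show ?thesis .
qed

text \<open>Since \<open>8 \<le> \<eta> * j\<close>, the \<open>l\<close>-th power of the base is at
  most \<open>exp (- 4 * \<nu>)\<close>, and \<open>4 * \<nu> \<ge> 3 * ln n\<close>.\<close>

lemma overlap_large:
  assumes "j < l" "l \<le> s"
  shows "overlap l \<le> exp (- 3 * ln n)"
proof -
  have l: "0 < l" using assms by simp
  have "overlap l \<le> (exp 1 * s / l) ^ l / real M ^ l * exp (L * (real l - 1) / 2) ^ l"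
    unfolding overlap_def L_bounds(5)[symmetric] exp_mult_choose_two
    by (intro mult_right_mono divide_right_mono binomial_le_exp_power[OF l]) auto
  also have "\<dots> = (exp 1 * s / l / M * exp (L * (real l - 1) / 2)) ^ l"
    by (simp only: power_mult_distrib power_divide)
  also have "\<dots> \<le> exp (- (\<eta> * \<nu> / 2)) ^ l"
    using l assms by (intro power_mono overlap_base) auto
  also have "\<dots> = exp (- (\<eta> * l) * \<nu> / 2)" by (simp add: exp_of_nat_mult[symmetric] algebra_simps)
  also have "\<dots> \<le> exp (- 3 * ln n)"
  proof -
    have "\<eta> * j \<le> \<eta> * l" using assms \<eta> by (intro mult_left_mono) auto
    then have "8 * \<nu> \<le> (\<eta> * l) * \<nu>" using j lam_bounds by (intro mult_right_mono) auto
    then have "6 * ln n \<le> \<eta> * l * \<nu>" using lam_bounds by linarith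
    then show ?thesis by simp
  qed
  finally show ?thesis .
qed

text \<open>Half of the budget goes to \<open>l = 2\<close>, the other half to all larger overlaps
  together.\<close>

lemma overlap_sum: "(\<Sum>l\<in>{2..s}. overlap l) \<le> 1 / (4 * n * ln n)"
proof -
  let ?c = "K ^ (j choose 2) * (8 * ln n ^ 4 / z\<^sup>2) ^ 3" and ?d = "exp (- 3 * ln n)"
  have c: "0 \<le> ?c" using L_bounds by simp
  have d: "0 \<le> ?d" by simp
  have "overlap l \<le> ?c + ?d" if "l \<in> {3..s}" for l
  proof (cases "l \<le> j")
    case True
    then have "overlap l \<le> ?c" using overlap_small that by simp
    then show ?thesis using d by linarith
  next
    case False
    then have "overlap l \<le> ?d" using overlap_large that by simp
    then show ?thesis using c by linarith
  qed
  then have "(\<Sum>l\<in>{3..s}. overlap l) \<le> real (card {3..s}) * (?c + ?d)" by (rule sum_bounded_above)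
  also have "\<dots> \<le> 2 * ln n * z * (?c + ?d)"
    using s_bounds x_bounds c by (intro mult_right_mono) auto
  also have "\<dots> \<le> 1 / (8 * n * ln n)" by (rule large_T)
  finally have "(\<Sum>l\<in>{3..s}. overlap l) \<le> 1 / (8 * n * ln n)" .
  moreover have "(\<Sum>l\<in>{2..s}. overlap l) = overlap 2 + (\<Sum>l\<in>{3..s}. overlap l)"
    using s_bounds by (subst sum.atLeast_Suc_atMost) (auto simp: numeral_eq_Suc)
  moreover have "1 / (8 * real n * ln n) + 1 / (8 * n * ln n) = 1 / (4 * n * ln n)"
    by (simp add: field_simps)
  ultimately show ?thesis using overlap_2 by linarith
qed

end

section \<open>Asymptotics\<close>

text \<open>Multiplied by \<open>a\<close>, all bounds compare with \<open>n\<close>. The lower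
  estimate uses \<open>(2 - \<delta>) * (1 + \<delta> / 2) \<le> 2\<close>; for
  \<open>\<delta> > 2\<close> its left side is not positive.\<close>

lemma ratio_from_sandwich:
  fixes k t a s B n :: nat and \<delta> :: real
  assumes n: "0 < n" and s: "0 < s" and low: "n \<le> k * a" "2 * n \<le> t * a"
    and up: "s * k \<le> n + s * B" "s * t \<le> 2 * (n + s * B)"
    and r: "real a / s + real (a * B) / n \<le> 1 + \<delta> / 2" and \<delta>: "0 < \<delta>"
  shows "(2 - \<delta>) * k \<le> t" "t \<le> (2 + \<delta>) * k"
proof -
  have a: "0 < a" using low(1) n by (auto intro: Nat.gr0I)
  have lowr: "real n \<le> k * a" "2 * real n \<le> t * a"
    using of_nat_mono[OF low(1), where ?'a = real] of_nat_mono[OF low(2), where ?'a = real] by simp_all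
  have eq: "a * (n / s + B) = n * (real a / s + real (a * B) / n)"
    using n s by (simp add: field_simps)
  also have "\<dots> \<le> n * (1 + \<delta> / 2)" using r by (intro mult_left_mono) auto
  finally have aB: "a * (n / s + B) \<le> n * (1 + \<delta> / 2)" .
  have "real (s * k) \<le> real (n + s * B)" using up(1) by (rule of_nat_mono)
  then have "real k \<le> n / s + B" using s by (simp add: field_simps)
  then have "k * real a \<le> (n / s + B) * a" by (intro mult_right_mono) auto
  then have chi: "k * real a \<le> n * (1 + \<delta> / 2)" using aB by (simp add: mult.commute)
  have "real (s * t) \<le> real (2 * (n + s * B))" using up(2) by (rule of_nat_mono)
  then have "real t \<le> 2 * (n / s + B)" using s by (simp add: field_simps)
  then have "t * real a \<le> 2 * (n / s + B) * a" by (intro mult_right_mono) auto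
  also have "\<dots> = 2 * (a * (n / s + B))" by simp
  also have "\<dots> \<le> 2 * (n * (1 + \<delta> / 2))" using aB by (intro mult_left_mono) auto
  also have "\<dots> = (2 + \<delta>) * n" by (simp add: algebra_simps)
  finally have tau: "t * real a \<le> (2 + \<delta>) * n" .
  have "(2 + \<delta>) * n \<le> (2 + \<delta>) * (k * a)" using lowr \<delta> by (intro mult_left_mono) auto
  then have "t * real a \<le> ((2 + \<delta>) * k) * a" using tau by (simp add: mult.assoc)
  then show "t \<le> (2 + \<delta>) * k" using a by simp
  show "(2 - \<delta>) * k \<le> t"
  proof (cases "\<delta> \<le> 2")
    case True
    have "(2 - \<delta>) * (k * a) \<le> (2 - \<delta>) * (n * (1 + \<delta> / 2))" using True chi by (intro mult_left_mono) auto
    also have "\<dots> = 2 * n - \<delta>\<^sup>2 / 2 * n" by (simp add: field_simps power2_eq_square)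
    also have "\<dots> \<le> 2 * n" by simp
    also have "\<dots> \<le> t * a" using lowr by simp
    finally have "((2 - \<delta>) * k) * a \<le> t * a" by (simp add: mult.assoc)
    then show ?thesis using a by simp
  next
    case False
    then have "(2 - \<delta>) * k \<le> 0" by (intro mult_nonpos_nonneg) auto
    then show ?thesis by linarith
  qed
qed

text \<open>Union bound over the three failures: a missing transversal, a small set of high minimum
  degree, a large stable set. The slack \<open>7 * \<eta>\<close> of \<open>ratio_bound\<close> must
  be at most \<open>\<delta> / 2\<close>.\<close>

lemma (in dense_regime) prob_tone_ratio:
  assumes \<delta>: "14 * \<eta> \<le> \<delta>"
  shows "1 - (exp (- (n * ln n)) + ((1 + exp (- 3 * ln n)) ^ n - 1) + exp 1 * K\<^sup>2 * exp (- (3 / 4 * \<eta> * ln n)))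
    \<le> measure_pmf.prob (Gnp n p)
        {E. (2 - \<delta>) * real (chromatic_number {0..<n} E) \<le> real (tone_number 2 {0..<n} E) \<and>
            real (tone_number 2 {0..<n} E) \<le> (2 + \<delta>) * real (chromatic_number {0..<n} E)}"
    (is "1 - (?e1 + ?e2 + ?e3) \<le> measure_pmf.prob _ ?G")
proof -
  let ?I = "all_edges n"
  let ?Q1 = "\<lambda>E. \<not> has_independent_transversals n E s M"
  let ?Q2 = "\<lambda>E. \<not> locally_degenerate n E m D"
  let ?Q3 = "\<lambda>E. \<exists>S\<subseteq>{0..<n}. stable_set E S \<and> a < card S"
  have p01: "0 \<le> p" "p \<le> 1" using p by auto
  have good: "E \<in> ?G" if "\<not> ?Q1 E" "\<not> ?Q2 E" "\<not> ?Q3 E" for E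
  proof -
    have tr: "has_independent_transversals n E s M" and deg: "locally_degenerate n E m D"
      and al: "\<And>S. S \<subseteq> {0..<n} \<Longrightarrow> stable_set E S \<Longrightarrow> card S \<le> a"
      using that by (auto simp: not_less)
    have s0: "0 < s" using s_bounds by simp
    have B: "n \<le> chromatic_number {0..<n} E * a" "2 * n \<le> tone_number 2 {0..<n} E * a"
      "s * chromatic_number {0..<n} E \<le> n + s * (D + a + 1)"
      "s * tone_number 2 {0..<n} E \<le> 2 * (n + s * (D + a + 1))"
      by (rule chromatic_and_tone_number_bounds[OF tr deg _ s0 size_condition n_pos(1)]; rule al; assumption)+
    have "real a / s + real (a * (D + a + 1)) / n \<le> 1 + \<delta> / 2" using ratio_bound \<delta> by linarith
    moreover have "0 < \<delta>" using \<delta> \<eta> by linarith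
    ultimately show ?thesis
      using ratio_from_sandwich[OF n_pos(1) s0 B, of \<delta>] by blast
  qed
  have T: "0 < 1 / (4 * n * ln n)" using n_pos ell by simp
  have "1 - measure_pmf.prob (Gnp n p) ?G = measure_pmf.prob (Gnp n p) (- ?G)"
    using measure_pmf.prob_compl[of ?G "Gnp n p"] by (simp add: Compl_eq_Diff_UNIV)
  also have "\<dots> = bexp p ?I (\<lambda>E. of_bool (E \<in> - ?G))"
    by (rule prob_Gnp_eq_bexp[OF p01])
  also have "\<dots> \<le> bexp p ?I (\<lambda>E. of_bool (?Q1 E) + (of_bool (?Q2 E) + of_bool (?Q3 E)))"
  proof (rule bexp_mono[OF p01])
    fix E
    show "of_bool (E \<in> - ?G) \<le> (of_bool (?Q1 E) + (of_bool (?Q2 E) + of_bool (?Q3 E)) :: real)"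
      using good[of E] by (cases "?Q1 E"; cases "?Q2 E"; cases "?Q3 E") auto
  qed
  also have "\<dots> = bexp p ?I (\<lambda>E. of_bool (?Q1 E)) + (bexp p ?I (\<lambda>E. of_bool (?Q2 E)) + bexp p ?I (\<lambda>E. of_bool (?Q3 E)))"
    by (simp only: bexp_add)
  also have "\<dots> \<le> ?e1 + (?e2 + ?e3)"
  proof (intro add_mono)
    \<comment> \<open>The Janson factor is \<open>exp (- 2 * n * ln n)\<close>, while the number of
      block families is at most \<open>n ^ n = exp (n * ln n)\<close>.\<close>
    have "bexp p ?I (\<lambda>E. of_bool (?Q1 E)) \<le> real (Suc s) ^ n * exp (- 1 / (2 * (1 / (4 * n * ln n))))"
      using no_independent_transversals_bound[OF p01(1) p(2) M_bounds(3) T] overlap_sum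
      by (simp only: overlap_def)
    also have "\<dots> \<le> real n ^ n * exp (- 1 / (2 * (1 / (4 * n * ln n))))"
      using s_less_n by (intro mult_right_mono power_mono) auto
    also have "real n ^ n = exp (n * ln n)"
      using n_pos by (simp add: exp_of_nat_mult)
    also have "exp (n * ln n) * exp (- 1 / (2 * (1 / (4 * n * ln n)))) = ?e1"
      by (simp flip: exp_add)
    finally show "bexp p ?I (\<lambda>E. of_bool (?Q1 E)) \<le> ?e1" .
    have "(1 + exp (- (m * p))) ^ n \<le> (1 + exp (- 3 * ln n)) ^ n"
      using exp_mp by (intro power_mono) (auto intro: add_nonneg_nonneg)
    then show "bexp p ?I (\<lambda>E. of_bool (?Q2 E)) \<le> ?e2"
      using not_locally_degenerate_bound[OF p01 D_bound(1), of n] by linarith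
    show "bexp p ?I (\<lambda>E. of_bool (?Q3 E)) \<le> ?e3"
      using large_stable_set_bound[OF p01, of n a] alpha_bound by linarith
  qed
  finally show ?thesis by linarith
qed

text \<open>\<open>A\<close> stands for the constant \<open>K ^ (j choose 2)\<close>, which keeps
  \<open>j\<close> out of the asymptotic analysis.\<close>

lemma eventually_large_conditions:
  fixes K \<eta> A :: real
  assumes \<eta>: "0 < \<eta>" and K: "0 < K"
  defines "z \<equiv> \<lambda>n::nat. real n powr (1/4)"
  shows "\<forall>\<^sub>F n::nat in sequentially. 1 \<le> ln (real n)"
    "\<forall>\<^sub>F n::nat in sequentially. 2 * ln n * z n + 8 * ln n ^ 2 * (z n)\<^sup>2 \<le> n / (2 * ln n ^ 2)"
    "\<forall>\<^sub>F n::nat in sequentially. K \<le> \<eta> * (3 / 2 * ln n)"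
    "\<forall>\<^sub>F n::nat in sequentially. 16 / ln n + 16 * ln n ^ 2 / (z n)\<^sup>2 + 4 * ln n / z n ^ 3 \<le> \<eta>"
    "\<forall>\<^sub>F n::nat in sequentially. 2 * ln n * z n + 1 \<le> n"
    "\<forall>\<^sub>F n::nat in sequentially. 3 * ln n \<le> z n ^ 3 / ln n ^ 2"
    "\<forall>\<^sub>F n::nat in sequentially. exp 1 * K\<^sup>2 * exp (- (3 / 4 * \<eta> * ln n)) \<le> 1"
    "\<forall>\<^sub>F n::nat in sequentially. 8 * ln n ^ 4 / (z n)\<^sup>2 \<le> 1"
    "\<forall>\<^sub>F n::nat in sequentially.
       2 * ln n * z n * (A * (8 * ln n ^ 4 / (z n)\<^sup>2) ^ 3 + exp (- 3 * ln n)) \<le> 1 / (8 * n * ln n)"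
    "\<forall>\<^sub>F n::nat in sequentially. 16 * exp 1 * ln n ^ 3 \<le> exp (3 / 8 * \<eta> * ln n)"
    "\<forall>\<^sub>F n::nat in sequentially. 8 * exp 1 * ln n ^ 4 / z n \<le> exp (- (ln n / 16))"
proof -
  show "\<forall>\<^sub>F n::nat in sequentially. 1 \<le> ln (real n)" by real_asymp
  show "\<forall>\<^sub>F n::nat in sequentially. 2 * ln n * z n + 8 * ln n ^ 2 * (z n)\<^sup>2 \<le> n / (2 * ln n ^ 2)"
    unfolding z_def by real_asymp
  show "\<forall>\<^sub>F n::nat in sequentially. K \<le> \<eta> * (3 / 2 * ln n)" using \<eta> by real_asymp
  have "(\<lambda>n::nat. 16 / ln n + 16 * ln n ^ 2 / (z n)\<^sup>2 + 4 * ln n / z n ^ 3) \<longlonglongrightarrow> 0"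
    unfolding z_def by real_asymp
  from order_tendstoD(2)[OF this \<eta>]
  show "\<forall>\<^sub>F n::nat in sequentially. 16 / ln n + 16 * ln n ^ 2 / (z n)\<^sup>2 + 4 * ln n / z n ^ 3 \<le> \<eta>"
    by (rule eventually_mono) simp
  show "\<forall>\<^sub>F n::nat in sequentially. 2 * ln n * z n + 1 \<le> n" unfolding z_def by real_asymp
  show "\<forall>\<^sub>F n::nat in sequentially. 3 * ln n \<le> z n ^ 3 / ln n ^ 2" unfolding z_def by real_asymp
  have "(\<lambda>n::nat. exp 1 * K\<^sup>2 * exp (- (3 / 4 * \<eta> * ln n))) \<longlonglongrightarrow> 0" using \<eta> by real_asymp
  from order_tendstoD(2)[OF this zero_less_one]
  show "\<forall>\<^sub>F n::nat in sequentially. exp 1 * K\<^sup>2 * exp (- (3 / 4 * \<eta> * ln n)) \<le> 1"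
    by (rule eventually_mono) simp
  show "\<forall>\<^sub>F n::nat in sequentially. 8 * ln n ^ 4 / (z n)\<^sup>2 \<le> 1" unfolding z_def by real_asymp
  \<comment> \<open>The sign of \<open>A\<close> is unknown, so the coefficient of \<open>A\<close>
    and the remaining part are sent to 0 separately.\<close>
  have "(\<lambda>n::nat. 2 * ln n * z n * (A * (8 * ln n ^ 4 / (z n)\<^sup>2) ^ 3 + exp (- 3 * ln n)) * (8 * n * ln n)) \<longlonglongrightarrow> 0"
  proof -
    have "(\<lambda>n::nat. 2 * ln n * z n * (8 * ln n ^ 4 / (z n)\<^sup>2) ^ 3 * (8 * n * ln n)) \<longlonglongrightarrow> 0"
      unfolding z_def by real_asymp
    moreover have "(\<lambda>n::nat. 2 * ln n * z n * exp (- 3 * ln n) * (8 * n * ln n)) \<longlonglongrightarrow> 0"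
      unfolding z_def by real_asymp
    ultimately have "(\<lambda>n::nat. A * (2 * ln n * z n * (8 * ln n ^ 4 / (z n)\<^sup>2) ^ 3 * (8 * n * ln n))
        + 2 * ln n * z n * exp (- 3 * ln n) * (8 * n * ln n)) \<longlonglongrightarrow> A * 0 + 0"
      by (intro tendsto_intros)
    then show ?thesis by (simp add: algebra_simps)
  qed
  from order_tendstoD(2)[OF this zero_less_one]
  have "\<forall>\<^sub>F n::nat in sequentially.
     2 * ln n * z n * (A * (8 * ln n ^ 4 / (z n)\<^sup>2) ^ 3 + exp (- 3 * ln n)) * (8 * n * ln n) < 1" .
  moreover have "\<forall>\<^sub>F n::nat in sequentially. 0 < 8 * n * ln n" by real_asymp
  ultimately show "\<forall>\<^sub>F n::nat in sequentially.
       2 * ln n * z n * (A * (8 * ln n ^ 4 / (z n)\<^sup>2) ^ 3 + exp (- 3 * ln n)) \<le> 1 / (8 * n * ln n)"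
    by eventually_elim (simp only: pos_le_divide_eq less_imp_le)
  show "\<forall>\<^sub>F n::nat in sequentially. 16 * exp 1 * ln n ^ 3 \<le> exp (3 / 8 * \<eta> * ln n)"
    using \<eta> by real_asymp
  show "\<forall>\<^sub>F n::nat in sequentially. 8 * exp 1 * ln n ^ 4 / z n \<le> exp (- (ln n / 16))"
    unfolding z_def by real_asymp
qed

lemma error_tendsto:
  fixes \<eta> K :: real
  assumes "0 < \<eta>"
  shows "(\<lambda>n::nat. 1 - (exp (- (n * ln n)) + ((1 + exp (- 3 * ln n)) ^ n - 1)
    + exp 1 * K\<^sup>2 * exp (- (3 / 4 * \<eta> * ln n)))) \<longlonglongrightarrow> 1"
proof -
  have "(\<lambda>n::nat. exp (- (n * ln n))) \<longlonglongrightarrow> 0" by real_asymp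
  moreover have "(\<lambda>n::nat. (1 + exp (- 3 * ln n)) ^ n) \<longlonglongrightarrow> 1" by real_asymp
  moreover have "(\<lambda>n::nat. exp 1 * K\<^sup>2 * exp (- (3 / 4 * \<eta> * ln n))) \<longlonglongrightarrow> 0"
    using assms by real_asymp
  ultimately have "(\<lambda>n::nat. 1 - (exp (- (n * ln n)) + ((1 + exp (- 3 * ln n)) ^ n - 1)
    + exp 1 * K\<^sup>2 * exp (- (3 / 4 * \<eta> * ln n)))) \<longlonglongrightarrow> 1 - (0 + (1 - 1) + 0)"
    by (intro tendsto_intros)
  then show ?thesis by simp
qed

text \<open>The fourth power of the hypothesis turns the exponents \<open>- 1 / 4\<close> and
  \<open>9 / 4\<close> into \<open>1 / n\<close> and \<open>ln n ^ 9\<close>; as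
  \<open>1 \<le> C\<close>, the constant \<open>C ^ 4\<close> is at least \<open>C\<close> and hence
  at least \<open>256 * K\<close>.\<close>

lemma density_bounds:
  fixes C K p \<epsilon> :: real and n :: nat
  assumes C: "1 \<le> C" "256 * K \<le> C" and K: "0 < K" and ell: "1 \<le> ln (real n)"
    and p: "C * real n powr (-1/4) * ln (real n) powr (9/4) \<le> p"
  shows "1 \<le> p * real n powr (1/4)" "256 * K * ln (real n) ^ 9 \<le> p ^ 4 * real n" "0 < p"
proof -
  have n: "0 < real n" using ell by (cases "n = 0") auto
  define z where "z = real n powr (1/4)"
  define b where "b = ln (real n) powr (9/4)"
  have z: "0 < z" "z ^ 4 = n"
  proof -
    show "0 < z" using n by (simp add: z_def)
    then have "z ^ 4 = z powr 4" by (simp add: powr_numeral)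
    then show "z ^ 4 = n" using n by (simp add: z_def powr_powr)
  qed
  have b1: "1 \<le> b" using ell by (simp add: b_def ge_one_powr_ge_zero)
  have "b ^ 4 = b powr 4" using b1 by (simp add: powr_numeral)
  also have "\<dots> = ln n powr 9" by (simp add: b_def powr_powr)
  also have "\<dots> = ln n ^ 9" using ell by (simp add: powr_numeral)
  finally have b4: "b ^ 4 = ln n ^ 9" .
  have "real n powr (-1/4) = 1 / z" by (simp add: z_def powr_minus_divide flip: minus_divide_left)
  then have *: "C * b / z \<le> p" using p by (simp add: b_def)
  then have pz: "C * b \<le> p * z" using z by (simp add: pos_divide_le_eq)
  have "1 * 1 \<le> C * b" using C b1 by (intro mult_mono) auto
  then show "1 \<le> p * real n powr (1/4)" using pz by (simp add: z_def)
  have "0 < C * b / z" using C b1 z by simp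
  then show "0 < p" using * by linarith
  have "256 * K * b ^ 4 \<le> C ^ 4 * b ^ 4"
  proof (rule mult_right_mono)
    have "C ^ 1 \<le> C ^ 4" using C by (intro power_increasing) auto
    then show "256 * K \<le> C ^ 4" using C by simp
  qed simp
  also have "\<dots> = (C * b) ^ 4" by (simp add: power_mult_distrib)
  also have "\<dots> \<le> (p * z) ^ 4" using pz C b1 by (intro power_mono) auto
  finally show "256 * K * ln (real n) ^ 9 \<le> p ^ 4 * real n"
    by (simp add: power_mult_distrib z b4)
qed

theorem theorem1:
  fixes \<epsilon> :: real
  assumes "\<epsilon> < 1"
  shows "\<exists>C0::real. \<forall>C \<ge> C0. \<forall>p :: nat \<Rightarrow> real.
     (\<forall>\<^sub>F n in sequentially.
        C * real n powr (-1/4) * ln (real n) powr (9/4) \<le> p n \<and> p n < \<epsilon>) \<longrightarrow>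
     (\<forall>\<delta>>0. (\<lambda>n. measure_pmf.prob (Gnp n (p n))
        {E. (2 - \<delta>) * real (chromatic_number {0..<n} E) \<le> real (tone_number 2 {0..<n} E) \<and>
            real (tone_number 2 {0..<n} E) \<le> (2 + \<delta>) * real (chromatic_number {0..<n} E)})
        \<longlonglongrightarrow> 1)"
proof -
  \<comment> \<open>A bound on \<open>1 / (1 - p n)\<close> uniform in \<open>n\<close>; the
    threshold for \<open>C\<close> depends on it alone and not on \<open>\<delta>\<close>.\<close>
  define K where "K = 1 / (1 - \<epsilon>)"
  have K: "0 < K" using assms by (simp add: K_def)
  show ?thesis
  proof (intro exI[of _ "max 1 (256 * K)"] allI impI)
    fix C :: real and p :: "nat \<Rightarrow> real" and \<delta> :: real
    assume C: "max 1 (256 * K) \<le> C"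
      and dense: "\<forall>\<^sub>F n in sequentially.
        C * real n powr (-1/4) * ln (real n) powr (9/4) \<le> p n \<and> p n < \<epsilon>"
      and \<delta>: "0 < \<delta>"
    let ?P = "\<lambda>n. measure_pmf.prob (Gnp n (p n))
        {E. (2 - \<delta>) * real (chromatic_number {0..<n} E) \<le> real (tone_number 2 {0..<n} E) \<and>
            real (tone_number 2 {0..<n} E) \<le> (2 + \<delta>) * real (chromatic_number {0..<n} E)}"
    \<comment> \<open>The two arguments are what \<open>dense_regime\<close> and
      \<open>prob_tone_ratio\<close> demand.\<close>
    define \<eta> where "\<eta> = min (1 / 8) (\<delta> / 14)"
    have \<eta>: "0 < \<eta>" "\<eta> \<le> 1 / 8" and \<eta>\<delta>: "14 * \<eta> \<le> \<delta>" using \<delta> by (auto simp: \<eta>_def)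
    define j where "j = nat \<lceil>8 / \<eta>\<rceil>"
    have j: "8 \<le> \<eta> * real j"
    proof -
      have "8 / \<eta> \<le> real j" unfolding j_def by linarith
      then show ?thesis using \<eta> by (simp add: pos_divide_le_eq mult.commute)
    qed
    have "\<forall>\<^sub>F n in sequentially. 1 - (exp (- (n * ln n)) + ((1 + exp (- 3 * ln n)) ^ n - 1)
        + exp 1 * K\<^sup>2 * exp (- (3 / 4 * \<eta> * ln n))) \<le> ?P n"
      using dense eventually_large_conditions(1-8,10,11)[OF \<eta>(1) K]
        eventually_large_conditions(9)[OF \<eta>(1) K, of "K ^ (j choose 2)"]
    proof eventually_elim
      case (elim n)
      have bounds: "1 \<le> p n * real n powr (1/4)" "256 * K * ln (real n) ^ 9 \<le> p n ^ 4 * real n" "0 < p n"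
        using density_bounds[of C K n "p n"] C K elim(1,2) by auto
      have "p n < 1" "1 / (1 - p n) \<le> K"
        using elim(1) assms by (auto simp: K_def intro!: divide_left_mono)
      then interpret dense_regime n j "p n" K \<eta> "- ln (1 - p n)" "ln (real n * p n)"
          "2 * ln (real n * p n) / (- ln (1 - p n))" "real n powr (1/4)"
          "nat \<lfloor>(1 - \<eta>) * (2 * ln (real n * p n) / (- ln (1 - p n)))\<rfloor>"
          "nat \<lfloor>(1 + \<eta>) * (2 * ln (real n * p n) / (- ln (1 - p n)))\<rfloor>"
          "nat \<lceil>real n / (2 * ln (real n) ^ 2 *
             real (nat \<lfloor>(1 - \<eta>) * (2 * ln (real n * p n) / (- ln (1 - p n)))\<rfloor>))\<rceil>"
          "nat \<lfloor>4 * (real n / ln (real n) ^ 2) * p n\<rfloor>"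
        using bounds \<eta>(1,2) j elim(2-) by unfold_locales (rule refl | assumption)+
      show ?case by (rule prob_tone_ratio[OF \<eta>\<delta>])
    qed
    then show "?P \<longlonglongrightarrow> 1"
      by (rule tendsto_sandwich[OF _ _ error_tendsto[OF \<eta>(1)] tendsto_const])
         (simp add: always_eventually)
  qed
qed

end
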